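(* Let $u\in L^{\infty}(\mathbb{R})\cap C^{\infty}(\mathbb{R})$ (in $x$, for each $t$) be a solution of the DNLS equation $\mathrm{i}u_t+u_{xx}+2\mathrm{i}(|u|^2u)_x=0$. Let $N\ge1$, let $\lambda_1,\dots,\lambda_N\in\mathbb{C}$ satisfy $\lambda_j^*\neq\pm\lambda_i$ for all $1\le i,j\le N$, and for each $i$ let $\varphi_i=(\varphi_i^{(1)},\varphi_i^{(2)})^T$ be a (vector) solution of the Lax pair $\varphi_x=\mathbf{U}(\mathbf{Q};\lambda_i)\varphi$, $\varphi_t=\mathbf{V}(\mathbf{Q};\lambda_i)\varphi$. Put $\varphi^{(k)}=(\varphi_1^{(k)},\dots,\varphi_N^{(k)})^T$ for $k=1,2$, $\mathbf{\Lambda}=\mathrm{diag}(\lambda_1,\dots,\lambda_N)$, and let $\mathbf{M}$ be the $N\times N$ matrix with entries $$\mathbf{M}_{ij}=\left(\frac{\varphi_j^{\dagger}\varphi_i}{\lambda_j^{*}-\lambda_i}-\frac{\varphi_j^{\dagger}\sigma_3\varphi_i}{\lambda_j^{*}+\lambda_i}\right)\lambda_i\lambda_j^{*}.$$ Assume $\mathbf{M}$ is invertible and $1-2\varphi^{(2)\dagger}\mathbf{\Lambda}^\dagger(\mathbf{M}^\dagger)^{-1}\varphi^{(2)}\neq 0$. Then $$u^{[N]}_\infty=\frac{1+2\varphi^{(1)\dagger}\mathbf{\Lambda}^\dagger\mathbf{M}^{-1}\varphi^{(1)}}{1-2\varphi^{(2)\dagger}\mathbf{\Lambda}^\dagger(\mathbf{M}^\dagger)^{-1}\varphi^{(2)}}\,u+\frac{4\varphi^{(2)\dagger}(\mathbf{\Lambda}^{\dagger})^2\mathbf{M}^{-1}\varphi^{(1)}}{1-2\varphi^{(2)\dagger}\mathbf{\Lambda}^\dagger(\mathbf{M}^\dagger)^{-1}\varphi^{(2)}}$$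 is again a solution of the DNLS equation.
   Context: $^*$ denotes complex conjugation and $^\dagger$ the conjugate transpose. $\sigma_3=\mathrm{diag}(1,-1)$, $\mathbf{Q}=\begin{pmatrix}0&\mathrm{i}u\\ \mathrm{i}u^*&0\end{pmatrix}$. The Lax pair of the DNLS equation is $\Phi_x=\mathbf{U}(\mathbf{Q};\lambda)\Phi$, $\Phi_t=\mathbf{V}(\mathbf{Q};\lambda)\Phi$ with $\mathbf{U}(\mathbf{Q};\lambda)=-2\mathrm{i}\sigma_3\lambda^2+2\mathbf{Q}\lambda$ and $\mathbf{V}(\mathbf{Q};\lambda)=(4\lambda^2+2\mathbf{Q}^2)\mathbf{U}(\mathbf{Q};\lambda)+2\mathrm{i}\sigma_3\mathbf{Q}_x\lambda$; its compatibility condition $\mathbf{U}_t-\mathbf{V}_x+[\mathbf{U},\mathbf{V}]=0$ is the DNLS equation. *)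

theory Defs
  imports "HOL-Analysis.Analysis"
begin

definition px :: "(real \<Rightarrow> real \<Rightarrow> 'a::real_normed_vector) \<Rightarrow> real \<Rightarrow> real \<Rightarrow> 'a" where
  "px f x t = vector_derivative (\<lambda>s. f s t) (at x)"

definition pt :: "(real \<Rightarrow> real \<Rightarrow> 'a::real_normed_vector) \<Rightarrow> real \<Rightarrow> real \<Rightarrow> 'a" where
  "pt f x t = vector_derivative (\<lambda>\<tau>. f x \<tau>) (at t)"

definition smooth_fun :: "(real \<Rightarrow> complex) \<Rightarrow> bool" where
  "smooth_fun f \<longleftrightarrow> (\<exists>D :: nat \<Rightarrow> real \<Rightarrow> complex. D 0 = f \<and>
      (\<forall>n y. (D n has_vector_derivative D (Suc n) y) (at y)))"

definition dnls_solution :: "(real \<Rightarrow> real \<Rightarrow> complex) \<Rightarrow> bool" where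
  "dnls_solution u \<longleftrightarrow> (\<forall>x t.
     (\<lambda>s. u s t) differentiable (at x) \<and>
     (\<lambda>s. px u s t) differentiable (at x) \<and>
     (\<lambda>\<tau>. u x \<tau>) differentiable (at t) \<and>
     (\<lambda>s. complex_of_real ((cmod (u s t))^2) * u s t) differentiable (at x) \<and>
     \<i> * pt u x t + px (px u) x t
       + 2 * \<i> * px (\<lambda>y \<tau>. complex_of_real ((cmod (u y \<tau>))^2) * u y \<tau>) x t = 0)"

definition sigma3 :: "complex^2^2" where
  "sigma3 = (\<chi> i j. if i = j then (if i = 1 then 1 else -1) else 0)"

definition Qm :: "complex \<Rightarrow> complex^2^2" where
  "Qm a = (\<chi> i j. if i = 1 \<and> j = 2 then \<i> * a
                    else if i = 2 \<and> j = 1 then \<i> * cnj a else 0)"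

definition mscale :: "'a::times \<Rightarrow> 'a^'n^'m \<Rightarrow> 'a^'n^'m" where
  "mscale c M = (\<chi> i j. c * M $ i $ j)"

definition ctrans :: "complex^'n^'m \<Rightarrow> complex^'m^'n" where
  "ctrans M = (\<chi> i j. cnj (M $ j $ i))"

definition cdot :: "complex^'n \<Rightarrow> complex^'n \<Rightarrow> complex" where
  "cdot v w = (\<Sum>k\<in>UNIV. cnj (v $ k) * w $ k)"

definition Umat :: "complex \<Rightarrow> complex \<Rightarrow> complex^2^2" where
  "Umat a lam = mscale (-2 * \<i> * lam^2) sigma3 + mscale (2 * lam) (Qm a)"

text \<open>V(Q;lam) = (4 lam^2 + 2 Q^2) U + 2 i sigma3 Q_x lam, with a = u and ax = u_x
  (so that Q_x = Qm ax).\<close>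
definition Vmat :: "complex \<Rightarrow> complex \<Rightarrow> complex \<Rightarrow> complex^2^2" where
  "Vmat a ax lam = (mscale (4 * lam^2) (mat 1) + mscale 2 (Qm a ** Qm a)) ** Umat a lam
                   + mscale (2 * \<i> * lam) (sigma3 ** Qm ax)"

definition Mmat :: "('n::finite \<Rightarrow> complex) \<Rightarrow> ('n \<Rightarrow> complex^2) \<Rightarrow> complex^'n^'n" where
  "Mmat lam ph = (\<chi> i j.
     (cdot (ph j) (ph i) / (cnj (lam j) - lam i)
      - cdot (ph j) (sigma3 *v ph i) / (cnj (lam j) + lam i)) * lam i * cnj (lam j))"

definition Lam :: "('n::finite \<Rightarrow> complex) \<Rightarrow> complex^'n^'n" where
  "Lam lam = (\<chi> i j. if i = j then lam i else 0)"

text \<open>The N-fold Darboux transformed field at a point, from the value a = u(x,t)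
  and the eigenfunction values ph i = phi_i(x,t).\<close>
definition uN :: "('n::finite \<Rightarrow> complex) \<Rightarrow> ('n \<Rightarrow> complex^2) \<Rightarrow> complex \<Rightarrow> complex" where
  "uN lam ph a =
    (let M = Mmat lam ph;
         p1 = (\<chi> i. ph i $ 1);
         p2 = (\<chi> i. ph i $ 2);
         LD = ctrans (Lam lam);
         den = 1 - 2 * cdot p2 ((LD ** matrix_inv (ctrans M)) *v p2)
     in (1 + 2 * cdot p1 ((LD ** matrix_inv M) *v p1)) / den * a
        + 4 * cdot p2 ((LD ** LD ** matrix_inv M) *v p1) / den)"

end

(* With z = lam^2, A = lam phi^(1) and B = phi^(2), the matrix M factors as 2 Lam K, where K is the
   Cauchy-like matrix K_ij = (A_i A_j' + z_j' B_i B_j') / (z_j' - z_i); the prime is complex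
   conjugation, and conjugate transposition for vectors and matrices. The Lax pair makes K_x and K_t
   sums of rank-one matrices, the Sylvester equation Z K - K Z' = - A A' - B B' Z' moves powers of Z
   in a product r K^{-1} Z c from the column to the row, and K' = B B' - K expresses complex
   conjugates. With
     g = 1 - B' K^{-1} B,  h = 1 + A' K^{-1} Z^{-1} A,  P = (B' K^{-1} A) / g
   one finds |g| = |h| = 1, A' K^{-1} B = - conj P, and the transformed field is g h (u + 2 P).
   Since g and h have the same logarithmic derivatives, the gauge factor g h drops out of the
   equation, and what remains is a polynomial identity in finitely many products r K^{-1} c. *)
theory Submission
  imports Defs
begin

section \<open>Diagonal scalings, the bilinear pairing and inverse matrices\<close>

definition bil :: "complex^'n \<Rightarrow> complex^'n \<Rightarrow> complex" where
  "bil r y = (\<Sum>i\<in>UNIV. r $ i * y $ i)"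

definition dg :: "('n \<Rightarrow> complex) \<Rightarrow> complex^'n \<Rightarrow> complex^'n" where
  "dg z v = (\<chi> i. z i * v $ i)"

definition conjv :: "complex^'n \<Rightarrow> complex^'n" where
  "conjv v = (\<chi> i. cnj (v $ i))"

definition outer :: "complex^'n \<Rightarrow> complex^'n \<Rightarrow> complex^'n^'n" where
  "outer c d = (\<chi> i j. c $ i * d $ j)"

definition cauchy_mat :: "('n \<Rightarrow> complex) \<Rightarrow> complex^'n \<Rightarrow> complex^'n \<Rightarrow> complex^'n^'n" where
  "cauchy_mat z A B =
    (\<chi> i j. (A $ i * cnj (A $ j) + B $ i * (cnj (z j) * cnj (B $ j))) / (cnj (z j) - z i))"

text \<open>The product r K^{-1} c of the introductory comment. The row enters without conjugation,
  so every complex conjugate is visible as a \<open>conjv\<close> or \<open>cnj\<close>.\<close>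

definition brk :: "complex^'n^'n \<Rightarrow> complex^'n \<Rightarrow> complex^'n \<Rightarrow> complex" where
  "brk K r c = bil r (matrix_inv K *v c)"

lemma dg_nth [simp]: "dg z v $ i = z i * v $ i"
  by (simp add: dg_def)

lemma conjv_nth [simp]: "conjv v $ i = cnj (v $ i)"
  by (simp add: conjv_def)

lemma outer_nth [simp]: "outer c d $ i $ j = c $ i * d $ j"
  by (simp add: outer_def)

lemma conjv_conjv [simp]: "conjv (conjv v) = v"
  by (simp add: vec_eq_iff)

lemma conjv_dg: "conjv (dg z v) = dg (\<lambda>i. cnj (z i)) (conjv v)"
  by (simp add: vec_eq_iff)

lemma conjv_add: "conjv (v + w) = conjv v + conjv w"
  by (simp add: vec_eq_iff)

lemma conjv_smult: "conjv (k *s v) = cnj k *s conjv v"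
  by (simp add: vec_eq_iff)

lemma dg_add: "dg z (v + w) = dg z v + dg z w"
  by (simp add: vec_eq_iff algebra_simps)

lemma dg_smult: "dg z (k *s v) = k *s dg z v"
  by (simp add: vec_eq_iff algebra_simps)

lemma dg_diff: "dg w (v - v') = dg w v - dg w v'"
  by (simp add: vec_eq_iff algebra_simps)

lemma dg_minus: "dg w (- v) = - dg w v"
  by (simp add: vec_eq_iff)

lemma outer_mult: "outer c d *v y = bil d y *s c"
  by (simp add: vec_eq_iff matrix_vector_mult_def bil_def sum_distrib_left sum_distrib_right
      mult_ac)

lemma bil_add_left: "bil (r + r') y = bil r y + bil r' y"
  by (simp add: bil_def sum.distrib algebra_simps)

lemma bil_add_right: "bil r (y + y') = bil r y + bil r y'"
  by (simp add: bil_def sum.distrib algebra_simps)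

lemma bil_smult_left: "bil (k *s r) y = k * bil r y"
  by (simp add: bil_def sum_distrib_left mult_ac)

lemma bil_smult_right: "bil r (k *s y) = k * bil r y"
  by (simp add: bil_def sum_distrib_left mult_ac)

lemma bil_diff_left: "bil (r - r') y = bil r y - bil r' y"
  by (simp add: bil_def sum_subtractf algebra_simps)

lemma bil_diff_right: "bil r (y - y') = bil r y - bil r y'"
  by (simp add: bil_def sum_subtractf algebra_simps)

lemma bil_dg: "bil r (dg z y) = bil (dg z r) y"
  by (simp add: bil_def mult_ac)

lemma matrix_vector_mult_smult: "(A::complex^'n^'m) *v (k *s v) = k *s (A *v v)"
  by (simp add: vec_eq_iff matrix_vector_mult_def sum_distrib_left mult_ac)

lemma matrix_inv_left_right:
  assumes "invertible K"
  shows "K ** matrix_inv K = mat 1" "matrix_inv K ** K = mat 1"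
  using assms someI_ex[of "\<lambda>A'. K ** A' = mat 1 \<and> A' ** K = mat 1"]
  unfolding invertible_def matrix_inv_def by blast+

lemma matrix_inv_vec:
  fixes K :: "complex^'n^'n"
  assumes "invertible K"
  shows "K *v (matrix_inv K *v c) = c" "matrix_inv K *v (K *v c) = c"
  by (simp_all add: matrix_vector_mul_assoc matrix_inv_left_right assms)

lemma matrix_inv_vec_eqI:
  fixes K :: "complex^'n^'n"
  assumes "invertible K" "K *v y = c"
  shows "matrix_inv K *v c = y"
  using matrix_inv_vec(2)[OF assms(1), of y] assms(2) by simp

lemma brk_linear:
  "brk K (r + r') c = brk K r c + brk K r' c"
  "brk K r (c + c') = brk K r c + brk K r c'"
  "brk K (k *s r) c = k * brk K r c"
  "brk K r (k *s c) = k * brk K r c"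
  "brk K (r - r') c = brk K r c - brk K r' c"
  "brk K r (c - c') = brk K r c - brk K r c'"
  by (simp_all add: brk_def bil_add_left bil_add_right bil_smult_left bil_smult_right
      bil_diff_left bil_diff_right
      matrix_vector_right_distrib matrix_vector_mult_smult matrix_vector_mult_diff_distrib)

lemma brk_minus: "brk K (- r) c = - brk K r c" "brk K r (- c) = - brk K r c"
  using brk_linear(5)[of K 0 r c] brk_linear(6)[of K r 0 c] brk_linear(3)[of K 0 r c]
      brk_linear(4)[of K r 0 c]
  by simp_all

section \<open>Algebra of the Cauchy-like matrix at a fixed point\<close>

locale cauchy =
  fixes z :: "'n::finite \<Rightarrow> complex" and A B :: "complex^'n"
  assumes sep: "cnj (z j) \<noteq> z i"
    and inv: "invertible (cauchy_mat z A B)"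
begin

abbreviation "zs \<equiv> \<lambda>i. cnj (z i)"
abbreviation "K \<equiv> cauchy_mat z A B"
abbreviation "ac \<equiv> conjv A"
abbreviation "bc \<equiv> conjv B"

text \<open>This is the Sylvester equation applied to a vector: clearing the denominator z_j' - z_i
  of entry (i, j) leaves two rank-one terms.\<close>

lemma K_dg: "dg z (K *v y) = K *v dg zs y - bil ac y *s A - bil (dg zs bc) y *s B"
proof -
  have e: "z i * K $ i $ j = K $ i $ j * zs j - cnj (A $ j) * A $ i
      - zs j * cnj (B $ j) * B $ i" for i j
    using sep[of j i] by (simp add: cauchy_mat_def field_simps)
  show ?thesis
    by (simp add: vec_eq_iff matrix_vector_mult_def bil_def sum_distrib_left sum_distrib_right
        mult.assoc[symmetric] e sum_subtractf[symmetric]) (simp add: algebra_simps)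
qed

text \<open>Applying K^{-1} to the Sylvester equation at y = K^{-1} c moves the factor Z from the
  column to the row, at the price of products of brackets.\<close>

lemma brk_shift:
  "brk K r (dg z c) = brk K (dg zs r) c - brk K r A * brk K ac c - brk K r B * brk K (dg zs bc) c"
proof -
  define y where "y = matrix_inv K *v c"
  have "dg z c = K *v dg zs y - bil ac y *s A - bil (dg zs bc) y *s B"
    using K_dg[of y] by (simp add: y_def matrix_inv_vec inv)
  then have "matrix_inv K *v dg z c =
      dg zs y - bil ac y *s (matrix_inv K *v A) - bil (dg zs bc) y *s (matrix_inv K *v B)"
    by (simp add: matrix_vector_mult_diff_distrib matrix_vector_mult_smult matrix_inv_vec inv)
  then show ?thesis
    by (simp add: brk_def bil_diff_right bil_smult_right bil_dg y_def mult_ac)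
qed

text \<open>When K and its conjugate transpose are added, the A-terms cancel and the B-terms acquire
  the factor z_j' - z_i, which removes the denominator.\<close>

lemma cnj_K: "cnj (K $ j $ i) = B $ i * cnj (B $ j) - K $ i $ j"
  using sep[of j i] sep[of i j] by (simp add: cauchy_mat_def) (simp add: field_simps)

text \<open>No inverse of the conjugate transpose is computed. With y = K^{-1} c and w = K^{-1} r',
  the number y' K w is evaluated in two ways, once by K w = r' and once by K = B B' - K'.\<close>

lemma cnj_brk:
  "cnj (brk K r c) = brk K bc (conjv r) * cnj (brk K bc c) - brk K (conjv c) (conjv r)"
proof -
  define y w where "y = matrix_inv K *v c" and "w = matrix_inv K *v conjv r"
  have Ky: "K *v y = c" and Kw: "K *v w = conjv r"
    by (simp_all add: y_def w_def matrix_inv_vec inv)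
  have "cnj (bil r y) = bil (conjv r) (conjv y)"
    by (simp add: bil_def)
  also have "\<dots> = bil (K *v w) (conjv y)"
    by (simp add: Kw)
  also have "\<dots> = (\<Sum>i\<in>UNIV. \<Sum>j\<in>UNIV. K $ i $ j * w $ j * cnj (y $ i))"
    by (simp add: bil_def matrix_vector_mult_def sum_distrib_right)
  also have "\<dots> = (\<Sum>i\<in>UNIV. \<Sum>j\<in>UNIV. B $ i * cnj (B $ j) * w $ j * cnj (y $ i)
        - cnj (K $ j $ i) * w $ j * cnj (y $ i))"
    by (simp add: cnj_K algebra_simps)
  also have "\<dots> = (\<Sum>i\<in>UNIV. \<Sum>j\<in>UNIV. B $ i * cnj (B $ j) * w $ j * cnj (y $ i))
       - (\<Sum>j\<in>UNIV. \<Sum>i\<in>UNIV. cnj (K $ j $ i) * w $ j * cnj (y $ i))"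
    by (subst (3) sum.swap) (simp add: sum_subtractf)
  also have "(\<Sum>i\<in>UNIV. \<Sum>j\<in>UNIV. B $ i * cnj (B $ j) * w $ j * cnj (y $ i)) = bil bc w * cnj (bil bc
      y)"
    by (simp add: bil_def sum_product mult_ac)
  also have "(\<Sum>j\<in>UNIV. \<Sum>i\<in>UNIV. cnj (K $ j $ i) * w $ j * cnj (y $ i)) = bil (conjv (K *v y)) w"
    by (simp add: bil_def matrix_vector_mult_def sum_distrib_right sum_distrib_left mult_ac)
  finally show ?thesis
    by (simp add: brk_def y_def[symmetric] w_def[symmetric] Ky)
qed

lemma z_nz: "z i \<noteq> 0"
  using sep[of i i] by auto

text \<open>The products r K^{-1} c with rows A' Z'^k, B' Z'^k and columns A, B, in the notation of the
  introductory comment. The definition of \<open>PP\<close> avoids a division, see \<open>pp_0\<close>.\<close>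

definition ra :: "nat \<Rightarrow> complex^'n" where "ra k = (dg zs ^^ k) (conjv A)"
definition rb :: "nat \<Rightarrow> complex^'n" where "rb k = (dg zs ^^ k) (conjv B)"
definition rr :: "nat \<Rightarrow> complex" where "rr k = brk K (ra k) A"
definition qq :: "nat \<Rightarrow> complex" where "qq k = brk K (ra k) B"
definition pp :: "nat \<Rightarrow> complex" where "pp k = brk K (rb k) A"
definition ss :: "nat \<Rightarrow> complex" where "ss k = brk K (rb k) B"

text \<open>In the application entry i is phi_i^(1) / lambda_i, the column that arises from phi^(1)
  when M is replaced by 2 Lam K.\<close>

definition E :: "complex^'n" where "E = dg (\<lambda>i. 1 / z i) A"
definition gg :: complex where "gg = 1 - ss 0"
definition hh :: complex where "hh = 1 + brk K (ra 0) E"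
definition PP :: complex where "PP = - cnj (qq 0)"

lemma ra_0: "ra 0 = conjv A" and rb_0: "rb 0 = conjv B"
  by (simp_all add: ra_def rb_def)

lemma dg_ra [simp]: "dg zs (ra k) = ra (Suc k)" and dg_rb [simp]: "dg zs (rb k) = rb (Suc k)"
  by (simp_all add: ra_def rb_def)

text \<open>Read from left to right, this removes one power of Z from the column; repeated use
  leaves only brackets with columns A and B.\<close>

lemma brk_dg:
  "brk K r (dg z c) = brk K (dg zs r) c - brk K r A * brk K (ra 0) c
      - brk K r B * brk K (rb (Suc 0)) c"
  using brk_shift[of r c] by (simp add: ra_0 flip: rb_0)

lemma dg_E: "dg z E = A"
  by (simp add: vec_eq_iff z_nz E_def)

text \<open>For s = B' K^{-1} B the conjugation formula reads conj s = s conj s - s, which factors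
  as (1 - s) (1 - conj s) = 1.\<close>

lemma gg_unit: "gg * cnj gg = 1"
  using cnj_brk[of "rb 0" B] by (simp add: gg_def ss_def rb_0 algebra_simps)

lemma gg_nz: "gg \<noteq> 0"
  using gg_unit by auto

text \<open>Identifies \<open>PP\<close> with the quotient P of the introductory comment. The
  conjugation formula gives cnj (qq 0) = - cnj gg * pp 0, and |gg| = 1 inverts the factor.\<close>

lemma pp_0: "pp 0 = gg * PP"
proof -
  have "cnj (qq 0) = - cnj gg * pp 0"
    using cnj_brk[of ac B] by (simp add: gg_def PP_def pp_def qq_def ss_def ra_0 rb_0 algebra_simps)
  then show ?thesis
    using gg_unit by (simp add: PP_def)
qed

text \<open>Since Z E = A, shifting Z in B' K^{-1} Z E gives a linear equation for this bracket,
  with the nonzero coefficient \<open>gg\<close>.\<close>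

lemma brk_rb_1_E: "brk K (rb (Suc 0)) E = PP * hh"
proof -
  have "gg * brk K (rb (Suc 0)) E = pp 0 * hh"
    using brk_dg[of "rb 0" E] by (simp add: dg_E gg_def pp_def hh_def ss_def algebra_simps)
  then show ?thesis
    by (simp add: pp_0 gg_nz)
qed

text \<open>The same shift for all higher rows. Brackets with column \<open>E\<close> thus carry the
  factor \<open>hh\<close>, which is what makes \<open>hh\<close> factor out of its own
  derivative.\<close>

lemma brk_Suc_E:
  "brk K (ra (Suc k)) E = (rr k + qq k * PP) * hh"
  "brk K (rb (Suc k)) E = (pp k + ss k * PP) * hh"
  using brk_dg[of "ra k" E] brk_dg[of "rb k" E]
  by (simp_all add: dg_E hh_def rr_def[symmetric] qq_def[symmetric] pp_def[symmetric]
      ss_def[symmetric]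
      brk_rb_1_E[unfolded hh_def] algebra_simps)

text \<open>The auxiliary bracket \<open>\<rho>\<close> is eliminated between two relations:
  conjugation of \<open>hh\<close> expresses cnj hh through it, and the shift with row E' gives a
  second equation relating it to \<open>hh\<close>.\<close>

lemma hh_unit: "hh * cnj hh = 1"
proof -
  define t \<rho> where "t = cnj (brk K bc E)" and "\<rho> = brk K (conjv E) A"
  have 1: "cnj hh = 1 + pp 0 * t - \<rho>"
    using cnj_brk[of ac E] by (simp add: t_def \<rho>_def hh_def pp_def ra_0 rb_0)
  have 2: "brk K (conjv E) B = - gg * t"
    using cnj_brk[of bc E] by (simp add: t_def gg_def ss_def rb_0 algebra_simps)
  have "dg zs (conjv E) = ac"
    using dg_E by (metis conjv_dg)
  then have "\<rho> = (hh - 1) - \<rho> * (hh - 1) + t * (gg * brk K (rb (Suc 0)) E)"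
    using brk_dg[of "conjv E" E] 2 by (simp add: dg_E \<rho>_def hh_def ra_0 algebra_simps)
  then have "\<rho> = (hh - 1) - \<rho> * (hh - 1) + t * (gg * PP * hh)"
    unfolding brk_rb_1_E by (simp add: mult_ac)
  with 1 show ?thesis
    unfolding pp_0 by algebra
qed

end

section \<open>Differentiating brackets through the inverse matrix\<close>

lemma differentiable_prod:
  fixes f :: "'i \<Rightarrow> real \<Rightarrow> complex"
  assumes "finite S" "\<And>i. i \<in> S \<Longrightarrow> f i differentiable at x"
  shows "(\<lambda>s. \<Prod>i\<in>S. f i s) differentiable at x"
  using assms by (induction S rule: finite_induct) auto

lemma differentiable_det:
  fixes M :: "real \<Rightarrow> complex^'n^'n"
  assumes "\<And>i j. (\<lambda>s. M s $ i $ j) differentiable at x"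
  shows "(\<lambda>s. det (M s)) differentiable at x"
  unfolding det_def
  by (intro differentiable_sum differentiable_mult differentiable_prod assms differentiable_const
      ballI)
     (simp_all add: finite_permutations)

text \<open>By Cramer's rule each component of the solution is a quotient of determinants with
  differentiable entries.\<close>

lemma differentiable_matrix_inv_vec:
  fixes K :: "real \<Rightarrow> complex^'n^'n" and c :: "real \<Rightarrow> complex^'n"
  assumes inv: "\<And>s. invertible (K s)"
    and K: "\<And>i j. (\<lambda>s. K s $ i $ j) differentiable at x"
    and c: "\<And>i. (\<lambda>s. c s $ i) differentiable at x"
  shows "(\<lambda>s. (matrix_inv (K s) *v c s) $ k) differentiable at x"
proof -
  have d: "det (K s) \<noteq> 0" for s
    using inv invertible_det_nz by blast
  have "(matrix_inv (K s) *v c s) $ k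
      = det (\<chi> i j. if j = k then c s $ i else K s $ i $ j) / det (K s)" for s
    using cramer[OF d[of s], of "matrix_inv (K s) *v c s" "c s"] by (simp add: matrix_inv_vec inv)
  moreover have "(\<lambda>s. (\<chi> i j. if j = k then c s $ i else K s $ i $ j) $ i' $ j') differentiable at
      x" for i' j'
    by (cases "j' = k") (simp_all add: K c)
  ultimately show ?thesis
    by (simp add: differentiable_det d K)
qed

text \<open>Cramer's rule gives only the existence of the derivative of y = K^{-1} c. Its value
  comes from differentiating K y = c and solving K y' = c' - K' y, where the prime now means the
  derivative.\<close>

lemma has_vector_derivative_brk:
  fixes K :: "real \<Rightarrow> complex^'n^'n"
  assumes inv: "\<And>s. invertible (K s)"
    and K: "\<And>i j. ((\<lambda>s. K s $ i $ j) has_vector_derivative K' $ i $ j) (at x)"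
    and r: "\<And>i. ((\<lambda>s. r s $ i) has_vector_derivative r' $ i) (at x)"
    and c: "\<And>i. ((\<lambda>s. c s $ i) has_vector_derivative c' $ i) (at x)"
  shows "((\<lambda>s. brk (K s) (r s) (c s)) has_vector_derivative
    brk (K x) r' (c x) + brk (K x) (r x) c' - brk (K x) (r x) (K' *v (matrix_inv (K x) *v c x))) (at
        x)"
proof -
  define y where "y = (\<lambda>s. matrix_inv (K s) *v c s)"
  have diff: "f differentiable at x" if "(f has_vector_derivative f') (at x)" for f :: "real \<Rightarrow>
      complex" and f'
    using that by (rule differentiableI_vector)
  have "(\<lambda>s. y s $ k) differentiable at x" for k
    unfolding y_def by (rule differentiable_matrix_inv_vec[OF inv diff[OF K] diff[OF c]])
  moreover define y' where "y' = (\<chi> k. vector_derivative (\<lambda>s. y s $ k) (at x))"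
  ultimately have y': "((\<lambda>s. y s $ k) has_vector_derivative y' $ k) (at x)" for k
    by (simp add: vector_derivative_works)
  have "((\<lambda>s. \<Sum>j\<in>UNIV. K s $ i $ j * y s $ j) has_vector_derivative
      (\<Sum>j\<in>UNIV. K x $ i $ j * y' $ j + K' $ i $ j * y x $ j)) (at x)" for i
    by (intro has_vector_derivative_sum has_vector_derivative_mult K y')
  moreover have "(\<Sum>j\<in>UNIV. K s $ i $ j * y s $ j) = c s $ i" for s i
    using matrix_inv_vec(1)[OF inv[of s], of "c s"] by
        (simp add: y_def vec_eq_iff matrix_vector_mult_def)
  ultimately have "((\<lambda>s. c s $ i) has_vector_derivative
      (\<Sum>j\<in>UNIV. K x $ i $ j * y' $ j + K' $ i $ j * y x $ j)) (at x)" for i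
    by simp
  from vector_derivative_unique_at[OF c this]
  have "c' $ i = (\<Sum>j\<in>UNIV. K x $ i $ j * y' $ j + K' $ i $ j * y x $ j)" for i .
  then have "K x *v y' = c' - K' *v y x"
    by (simp add: vec_eq_iff matrix_vector_mult_def sum.distrib)
  then have "y' = matrix_inv (K x) *v (c' - K' *v y x)"
    by (metis matrix_inv_vec(2) inv)
  then have y'_eq: "y' = matrix_inv (K x) *v c' - matrix_inv (K x) *v (K' *v y x)"
    by (simp add: matrix_vector_mult_diff_distrib)
  have "((\<lambda>s. \<Sum>j\<in>UNIV. r s $ j * y s $ j) has_vector_derivative
      (\<Sum>j\<in>UNIV. r x $ j * y' $ j + r' $ j * y x $ j)) (at x)"
    by (intro has_vector_derivative_sum has_vector_derivative_mult r y')
  moreover have "(\<Sum>j\<in>UNIV. r x $ j * y' $ j + r' $ j * y x $ j) =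
      brk (K x) r' (c x) + brk (K x) (r x) c' - brk (K x) (r x) (K' *v (matrix_inv (K x) *v c x))"
    by (simp add: brk_def sum.distrib flip: bil_def) (simp add: y'_eq bil_diff_right y_def)
  ultimately show ?thesis
    by (simp add: brk_def bil_def y_def)
qed

definition vder :: "(real \<Rightarrow> complex^'n) \<Rightarrow> complex^'n \<Rightarrow> real \<Rightarrow> bool" where
  "vder r r' x \<longleftrightarrow> (\<forall>i. ((\<lambda>s. r s $ i) has_vector_derivative r' $ i) (at x))"

lemma vder_conjv: "vder r r' x \<Longrightarrow> vder (\<lambda>s. conjv (r s)) (conjv r') x"
  by (auto simp: vder_def intro: has_vector_derivative_cnj)

lemma vder_dg: "vder r r' x \<Longrightarrow> vder (\<lambda>s. dg z (r s)) (dg z r') x"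
  by (auto simp: vder_def intro: has_vector_derivative_mult_right)

section \<open>Brackets along a curve, the parameter being x at fixed t or t at fixed x\<close>

locale cauchy_curve =
  fixes z :: "'n::finite \<Rightarrow> complex" and A B :: "real \<Rightarrow> complex^'n"
  assumes curve_sep: "cnj (z j) \<noteq> z i"
    and curve_inv: "invertible (cauchy_mat z (A s) (B s))"
begin

sublocale at: cauchy z "A s" "B s" for s
  by unfold_locales (simp_all add: curve_sep curve_inv)

abbreviation "zc \<equiv> \<lambda>i. cnj (z i)"
abbreviation "KK s \<equiv> cauchy_mat z (A s) (B s)"

text \<open>The derivative of K is given by its products with z_j' - z_i. A proposed sum of rank-one
  matrices can then be checked by a polynomial identity without division.\<close>

lemma vder_brk:
  assumes "vder A A' x" "vder B B' x" "vder r r' x" "vder c c' x"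
    and K': "\<And>i j. K' $ i $ j * (zc j - z i) =
      A' $ i * cnj (A x $ j) + A x $ i * cnj (A' $ j) + (B' $ i * (zc j * cnj (B x $ j))
          + B x $ i * (zc j * cnj (B' $ j)))"
  shows "((\<lambda>s. brk (KK s) (r s) (c s)) has_vector_derivative
    brk (KK x) r' (c x) + brk (KK x) (r x) c' - brk (KK x) (r x) (K' *v (matrix_inv (KK x) *v c x)))
        (at x)"
proof (rule has_vector_derivative_brk)
  fix i j
  have A: "((\<lambda>s. A s $ k) has_vector_derivative A' $ k) (at x)"
    and B: "((\<lambda>s. B s $ k) has_vector_derivative B' $ k) (at x)" for k
    using assms by (simp_all add: vder_def)
  have eq: "K' $ i $ j = (A x $ i * cnj (A' $ j) + A' $ i * cnj (A x $ j) +
       (B x $ i * (zc j * cnj (B' $ j)) + B' $ i * (zc j * cnj (B x $ j)))) / (zc j - z i)"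
    using K'[of i j] curve_sep[of j i] by (simp add: eq_divide_eq add_ac)
  show "((\<lambda>s. KK s $ i $ j) has_vector_derivative K' $ i $ j) (at x)"
    unfolding cauchy_mat_def vec_lambda_beta eq
    by (intro has_vector_derivative_divide has_vector_derivative_add has_vector_derivative_mult
        has_vector_derivative_mult_right has_vector_derivative_cnj A B)
qed (use assms curve_inv in \<open>simp_all add: vder_def\<close>)

abbreviation "ra k s \<equiv> cauchy.ra z (A s) k"
abbreviation "rb k s \<equiv> cauchy.rb z (B s) k"
abbreviation "rr k s \<equiv> cauchy.rr z (A s) (B s) k"
abbreviation "qq k s \<equiv> cauchy.qq z (A s) (B s) k"
abbreviation "pp k s \<equiv> cauchy.pp z (A s) (B s) k"
abbreviation "ss k s \<equiv> cauchy.ss z (A s) (B s) k"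
abbreviation "gg s \<equiv> cauchy.gg z (A s) (B s)"
abbreviation "hh s \<equiv> cauchy.hh z (A s) (B s)"
abbreviation "PP s \<equiv> cauchy.PP z (A s) (B s)"

text \<open>Together these rules expand any bracket of combinations of Z^k A and Z^k B against the
  rows \<open>ra\<close>, \<open>rb\<close> into the scalars \<open>rr\<close>, \<open>qq\<close>,
  \<open>pp\<close>, \<open>ss\<close>.\<close>

lemmas brk_atoms = brk_linear brk_minus at.brk_dg at.rr_def[symmetric] at.qq_def[symmetric]
  at.pp_def[symmetric] at.ss_def[symmetric]

lemma vder_ra_rb:
  assumes "vder A A' x" "vder B B' x"
  shows "vder (ra k) ((dg zc ^^ k) (conjv A')) x" "vder (rb k) ((dg zc ^^ k) (conjv B')) x"
  unfolding at.ra_def at.rb_def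
  by (induction k) (simp_all add: vder_dg vder_conjv assms)

lemma funpow_dg_linear:
  "(dg w ^^ k) (v + v') = (dg w ^^ k) v + (dg w ^^ k) v'"
  "(dg w ^^ k) (c *s v) = c *s (dg w ^^ k) v"
  by (induction k) (simp_all add: dg_add dg_smult)

lemma funpow_dg_rows:
  "(dg zc ^^ k) (conjv (A s)) = ra k s" "(dg zc ^^ k) (conjv (B s)) = rb k s"
  "(dg zc ^^ k) (dg zc v) = dg zc ((dg zc ^^ k) v)"
  by (simp_all add: at.ra_def at.rb_def funpow_swap1)

lemmas row_simps = conjv_add conjv_smult conjv_dg funpow_dg_linear funpow_dg_rows

text \<open>The Lax pair in the variables A, B, in which the spectral parameter enters
  through its square only.\<close>

definition flow_x :: "complex \<Rightarrow> real \<Rightarrow> bool" where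
  "flow_x u x \<longleftrightarrow>
    vder A ((-2 * \<i>) *s dg z (A x) + (2 * \<i> * u) *s dg z (B x)) x \<and>
    vder B ((2 * \<i>) *s dg z (B x) + (2 * \<i> * cnj u) *s A x) x"

text \<open>In the derivative of the numerator of \<open>cauchy_mat\<close> the terms with cnj u
  cancel and the rest is divisible by z_j' - z_i. The quotient is the sum \<open>?K'\<close> of
  three rank-one matrices.\<close>

lemma brk_flow_x:
  assumes "flow_x u x" "vder r r' x" "vder c c' x"
  shows "((\<lambda>s. brk (KK s) (r s) (c s)) has_vector_derivative
    brk (KK x) r' (c x) + brk (KK x) (r x) c'
     - 2 * \<i> * (brk (KK x) (r x) (A x) * brk (KK x) (ra 0 x) (c x)
       - brk (KK x) (r x) (B x) * brk (KK x) (rb 1 x) (c x)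
       - u * brk (KK x) (r x) (B x) * brk (KK x) (ra 0 x) (c x))) (at x)"
proof -
  let ?K' = "outer ((2 * \<i>) *s A x) (ra 0 x) + outer ((- 2 * \<i>) *s B x) (rb 1 x)
     + outer ((- 2 * \<i> * u) *s B x) (ra 0 x)"
  have "((\<lambda>s. brk (KK s) (r s) (c s)) has_vector_derivative
    brk (KK x) r' (c x) + brk (KK x) (r x) c' - brk (KK x) (r x) (?K' *v (matrix_inv (KK x) *v c
        x))) (at x)"
  proof (rule vder_brk)
    show "vder A ((-2 * \<i>) *s dg z (A x) + (2 * \<i> * u) *s dg z (B x)) x"
      "vder B ((2 * \<i>) *s dg z (B x) + (2 * \<i> * cnj u) *s A x) x"
      using assms(1) by (simp_all only: flow_x_def)
  qed (use assms in \<open>simp_all add: at.ra_def at.rb_def, algebra?\<close>)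
  then show ?thesis
    by (rule has_vector_derivative_eq_rhs)
       (simp add: matrix_vector_mult_add_rdistrib outer_mult brk_linear brk_minus brk_def[of _
           "cauchy.ra _ _ _"] brk_def[of _ "cauchy.rb _ _ _"] algebra_simps)
qed

text \<open>The x-flow closes on the brackets, and the index grows by at most one because the flow
  is of first order in z. Two x-derivatives starting from index 0 therefore reach index 2.\<close>

lemma brackets_deriv_x:
  assumes "flow_x u x"
  shows "((\<lambda>s. rr k s) has_vector_derivative
      - 2 * \<i> * cnj u * pp (Suc k) x + 4 * \<i> * qq k x * pp 1 x
      + 2 * \<i> * u * (qq (Suc k) x - rr k x * qq 0 x - qq k x * ss 1 x
          + qq k x * rr 0 x)) (at x)" (is ?g1)
    and "((\<lambda>s. qq k s) has_vector_derivative
      4 * \<i> * qq (Suc k) x - 2 * \<i> * cnj u * ss (Suc k) x - 4 * \<i> * rr k x * qq 0 x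
      + 2 * \<i> * cnj u * rr k x + 2 * \<i> * u * qq k x * qq 0 x) (at x)" (is ?g2)
    and "((\<lambda>s. pp k s) has_vector_derivative
      - 4 * \<i> * pp (Suc k) x - 2 * \<i> * u * rr k x + 4 * \<i> * ss k x * pp 1 x
      + 2 * \<i> * u * (ss (Suc k) x - pp k x * qq 0 x - ss k x * ss 1 x
          + ss k x * rr 0 x)) (at x)" (is ?g3)
    and "((\<lambda>s. ss k s) has_vector_derivative
      - 2 * \<i> * u * qq k x - 4 * \<i> * pp k x * qq 0 x
      + 2 * \<i> * cnj u * pp k x + 2 * \<i> * u * ss k x * qq 0 x) (at x)" (is ?g4)
proof -
  note A = assms[unfolded flow_x_def, THEN conjunct1] and B = assms[unfolded flow_x_def, THEN
      conjunct2]
  note ab = vder_ra_rb[OF A B, of k, unfolded row_simps]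
  show ?g1
    unfolding at.rr_def at.qq_def at.pp_def at.ss_def
    by (rule has_vector_derivative_eq_rhs[OF brk_flow_x[OF assms ab(1) A]])
       (simp add: brk_atoms algebra_simps)
  show ?g2
    unfolding at.rr_def at.qq_def at.pp_def at.ss_def
    by (rule has_vector_derivative_eq_rhs[OF brk_flow_x[OF assms ab(1) B]])
       (simp add: brk_atoms algebra_simps)
  show ?g3
    unfolding at.rr_def at.qq_def at.pp_def at.ss_def
    by (rule has_vector_derivative_eq_rhs[OF brk_flow_x[OF assms ab(2) A]])
       (simp add: brk_atoms algebra_simps)
  show ?g4
    unfolding at.rr_def at.qq_def at.pp_def at.ss_def
    by (rule has_vector_derivative_eq_rhs[OF brk_flow_x[OF assms ab(2) B]])
       (simp add: brk_atoms algebra_simps)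
qed

text \<open>The time part of the Lax pair in the same variables. Here the parameter \<open>x\<close>
  is a time, and \<open>ux\<close> stands for the spatial derivative of u.\<close>

definition flow_t :: "complex \<Rightarrow> complex \<Rightarrow> real \<Rightarrow> bool" where
  "flow_t u ux x \<longleftrightarrow>
    vder A ((-8 * \<i>) *s dg z (dg z (A x)) + (8 * \<i> * u) *s dg z (dg z (B x))
      + (4 * \<i> * u * cnj u) *s dg z (A x) + (-4 * \<i> * u * u * cnj u - 2 * ux) *s dg z (B x)) x \<and>
    vder B ((8 * \<i>) *s dg z (dg z (B x)) + (8 * \<i> * cnj u) *s dg z (A x)
      + (-4 * \<i> * u * cnj u) *s dg z (B x) + (-4 * \<i> * u * cnj u * cnj u + 2 * cnj ux) *s A x) x"

text \<open>As for the x-flow, but now quadratic in z. A factor z_j'^2 - z_i^2 leaves z_j' + z_i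
  after division, so such a term contributes two rank-one matrices, one with Z on the row and one
  with Z on the column.\<close>

lemma brk_flow_t:
  assumes "flow_t u ux x" "vder r r' x" "vder c c' x"
  shows "((\<lambda>s. brk (KK s) (r s) (c s)) has_vector_derivative
    brk (KK x) r' (c x) + brk (KK x) (r x) c'
    - (- 4 * \<i> * u * cnj u * brk (KK x) (r x) (A x) * brk (KK x) (ra 0 x) (c x)
      + 4 * \<i> * u * cnj u * brk (KK x) (r x) (B x) * brk (KK x) (rb 1 x) (c x)
      + (4 * \<i> * u * u * cnj u + 2 * ux) * brk (KK x) (r x) (B x) * brk (KK x) (ra 0 x) (c x)
      + 8 * \<i> * brk (KK x) (r x) (A x) * brk (KK x) (ra 1 x) (c x)
      - 8 * \<i> * brk (KK x) (r x) (B x) * brk (KK x) (rb 2 x) (c x)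
      - 8 * \<i> * u * brk (KK x) (r x) (B x) * brk (KK x) (ra 1 x) (c x)
      + 8 * \<i> * brk (KK x) (r x) (dg z (A x)) * brk (KK x) (ra 0 x) (c x)
      - 8 * \<i> * u * brk (KK x) (r x) (dg z (B x)) * brk (KK x) (ra 0 x) (c x)
      - 8 * \<i> * brk (KK x) (r x) (dg z (B x)) * brk (KK x) (rb 1 x) (c x)
      - 8 * \<i> * cnj u * brk (KK x) (r x) (A x) * brk (KK x) (rb 1 x) (c x))) (at x)"
proof -
  let ?K' = "outer ((- 4 * \<i> * u * cnj u) *s A x) (ra 0 x)
      + outer ((4 * \<i> * u * cnj u) *s B x) (rb 1 x)
     + outer ((4 * \<i> * u * u * cnj u + 2 * ux) *s B x) (ra 0 x)
     + outer ((8 * \<i>) *s A x) (ra 1 x) + outer ((- 8 * \<i>) *s B x) (rb 2 x)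
     + outer ((- 8 * \<i> * u) *s B x) (ra 1 x) + outer ((8 * \<i>) *s dg z (A x)) (ra 0 x)
     + outer ((- 8 * \<i> * u) *s dg z (B x)) (ra 0 x) + outer ((- 8 * \<i>) *s dg z (B x)) (rb 1 x)
     + outer ((- 8 * \<i> * cnj u) *s A x) (rb 1 x)"
  have "((\<lambda>s. brk (KK s) (r s) (c s)) has_vector_derivative
    brk (KK x) r' (c x) + brk (KK x) (r x) c' - brk (KK x) (r x) (?K' *v (matrix_inv (KK x) *v c
        x))) (at x)"
  proof (rule vder_brk)
    show "vder A ((-8 * \<i>) *s dg z (dg z (A x)) + (8 * \<i> * u) *s dg z (dg z (B x))
      + (4 * \<i> * u * cnj u) *s dg z (A x) + (-4 * \<i> * u * u * cnj u - 2 * ux) *s dg z (B x)) x"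
    "vder B ((8 * \<i>) *s dg z (dg z (B x)) + (8 * \<i> * cnj u) *s dg z (A x)
      + (-4 * \<i> * u * cnj u) *s dg z (B x) + (-4 * \<i> * u * cnj u * cnj u + 2 * cnj ux) *s A x) x"
      using assms(1) by (simp_all only: flow_t_def)
  qed (use assms in \<open>simp_all add: at.ra_def at.rb_def numeral_2_eq_2, algebra?\<close>)
  then show ?thesis
    by (rule has_vector_derivative_eq_rhs)
       (simp add: matrix_vector_mult_add_rdistrib outer_mult brk_linear brk_minus brk_def[of _
           "cauchy.ra _ _ _"] brk_def[of _ "cauchy.rb _ _ _"] algebra_simps)
qed

text \<open>Index 0 suffices, as the equation is of first order in t: \<open>ss 0\<close> determines
  \<open>gg\<close>, and \<open>pp 0\<close> then determines the derivative of
  \<open>PP\<close>.\<close>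

lemma brackets_deriv_t:
  assumes "flow_t u ux x"
  shows "((\<lambda>s. pp 0 s) has_vector_derivative -16 * \<i> * pp 0 x * pp 1 x * qq 0 x
      + 8 * \<i> * pp 0 x * pp 1 x * cnj u + 8 * \<i> * pp 0 x * qq 0 x * ss 1 x * u
      + 4 * \<i> * pp 0 x * qq 0 x * u^2 * cnj u + 2 * pp 0 x * qq 0 x * ux
      - 8 * \<i> * pp 0 x * qq 1 x * u + 8 * \<i> * pp 1 x * qq 0 x * ss 0 x * u
      - 8 * \<i> * pp 1 x * qq 0 x * u - 16 * \<i> * pp 1 x * ss 0 x * ss 1 x
      - 8 * \<i> * pp 1 x * ss 0 x * u * cnj u + 16 * \<i> * pp 1 x * ss 1 x + 8 * \<i> * pp 1 x * u * cnj u
      - 16 * \<i> * pp 2 x + 16 * \<i> * pp 2 x * ss 0 x - 8 * \<i> * rr 0 x * ss 0 x * ss 1 x * u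
      - 4 * \<i> * rr 0 x * ss 0 x * u^2 * cnj u - 2 * rr 0 x * ss 0 x * ux
      + 8 * \<i> * rr 0 x * ss 1 x * u + 4 * \<i> * rr 0 x * u^2 * cnj u + 2 * rr 0 x * ux
      + 8 * \<i> * rr 1 x * ss 0 x * u - 8 * \<i> * rr 1 x * u + 4 * \<i> * ss 0 x * ss 1 x * u^2 * cnj u
      + 2 * ss 0 x * ss 1 x * ux + 8 * \<i> * ss 0 x * ss 1 x^2 * u - 8 * \<i> * ss 0 x * ss 2 x * u
      - 4 * \<i> * ss 1 x * u^2 * cnj u - 2 * ss 1 x * ux - 8 * \<i> * ss 1 x^2 * u
      + 8 * \<i> * ss 2 x * u) (at x)" (is ?g1)
    and "((\<lambda>s. ss 0 s) has_vector_derivative 16 * \<i> * pp 0 x * qq 0 x * rr 0 x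
        + 8 * \<i> * pp 0 x * qq 0 x * u * cnj u - 8 * \<i> * pp 0 x * qq 0 x^2 * u
        - 16 * \<i> * pp 0 x * qq 1 x - 8 * \<i> * pp 0 x * rr 0 x * cnj u
        + 8 * \<i> * pp 0 x * ss 1 x * cnj u - 4 * \<i> * pp 0 x * u * cnj u^2 + 2 * pp 0 x * cnj ux
        - 16 * \<i> * pp 1 x * qq 0 x + 16 * \<i> * pp 1 x * qq 0 x * ss 0 x
        - 8 * \<i> * pp 1 x * ss 0 x * cnj u + 8 * \<i> * pp 1 x * cnj u
        - 8 * \<i> * qq 0 x * ss 0 x * ss 1 x * u - 4 * \<i> * qq 0 x * ss 0 x * u^2 * cnj u
        - 2 * qq 0 x * ss 0 x * ux + 8 * \<i> * qq 0 x * ss 1 x * u + 4 * \<i> * qq 0 x * u^2 * cnj u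
        + 2 * qq 0 x * ux + 8 * \<i> * qq 1 x * ss 0 x * u - 8 * \<i> * qq 1 x * u) (at x)" (is ?g2)
    and "\<exists>D. ((\<lambda>s. qq 0 s) has_vector_derivative D) (at x)" (is ?g3)
proof -
  note A = assms[unfolded flow_t_def, THEN conjunct1] and B = assms[unfolded flow_t_def, THEN
      conjunct2]
  note ab = vder_ra_rb[OF A B, of 0, unfolded row_simps]
  show ?g1
    unfolding at.rr_def at.qq_def at.pp_def at.ss_def
    by (rule has_vector_derivative_eq_rhs[OF brk_flow_t[OF assms ab(2) A]])
       (simp add: brk_atoms numeral_2_eq_2 algebra_simps)
  show ?g2
    unfolding at.rr_def at.qq_def at.pp_def at.ss_def
    by (rule has_vector_derivative_eq_rhs[OF brk_flow_t[OF assms ab(2) B]])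
       (simp add: brk_atoms numeral_2_eq_2 algebra_simps)
  show ?g3
    unfolding at.rr_def at.qq_def at.pp_def at.ss_def using brk_flow_t[OF assms ab(1) B] by blast
qed

end

text \<open>The product rule solved for one factor. The division by \<open>k x\<close> is replaced
  by an equation that is polynomial when the data are.\<close>

lemma has_vector_derivative_cofactor:
  fixes f k :: "real \<Rightarrow> complex"
  assumes "f differentiable at x" "(k has_vector_derivative k') (at x)"
    and "((\<lambda>s. k s * f s) has_vector_derivative D) (at x)"
    and "k x * f' + k' * f x = D" "k x \<noteq> 0"
  shows "(f has_vector_derivative f') (at x)"
proof -
  define d where "d = vector_derivative f (at x)"
  have d: "(f has_vector_derivative d) (at x)"
    using assms(1) by (simp add: d_def vector_derivative_works)
  have "k x * d + k' * f x = D"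
    using vector_derivative_unique_at[OF has_vector_derivative_mult[OF assms(2) d] assms(3)] .
  then have "d = f'"
    using assms(4,5) by (metis add_right_cancel mult_left_cancel)
  then show ?thesis
    using d by simp
qed

section \<open>Derivatives of the unimodular factors \<open>gg\<close>, \<open>hh\<close> and of
  \<open>PP\<close>\<close>

context cauchy_curve
begin

lemma vder_E: "vder A A' x \<Longrightarrow> vder (\<lambda>s. cauchy.E z (A s)) (dg (\<lambda>i. 1 / z i) A') x"
  unfolding at.E_def by (rule vder_dg)

lemma dg_inverse: "dg (\<lambda>i. 1 / z i) (dg z v) = v"
  using at.z_nz by (simp add: vec_eq_iff)

lemma brk_ra_0_E: "brk (KK s) (ra 0 s) (cauchy.E z (A s)) = hh s - 1"
  by (simp add: at.hh_def)

lemma pp_0': "pp 0 s = (1 - ss 0 s) * PP s"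
  using at.pp_0 by (simp add: at.gg_def)

text \<open>Substituting pp 0 = (1 - ss 0) * PP into the derivative of \<open>ss 0\<close> makes 1 -
  ss 0, that is \<open>gg\<close>, a common factor.\<close>

lemma gg_deriv_x:
  assumes "flow_x u x"
  shows "((\<lambda>s. gg s) has_vector_derivative gg x * (4 * \<i> * PP x * qq 0 x - 2 * \<i> * PP x * cnj u
      + 2 * \<i> * qq 0 x * u)) (at x)"
  unfolding at.gg_def
  by (rule has_vector_derivative_eq_rhs[OF has_vector_derivative_diff[OF has_vector_derivative_const
      brackets_deriv_x(4)[OF assms]]])
     (simp only: pp_0', algebra)

lemma gg_deriv_t:
  assumes "flow_t u ux x"
  shows "((\<lambda>s. gg s) has_vector_derivative gg x * (-16 * \<i> * PP x * qq 0 x * rr 0 x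
      - 8 * \<i> * PP x * qq 0 x * u * cnj u + 8 * \<i> * PP x * qq 0 x^2 * u + 16 * \<i> * PP x * qq 1 x
      + 8 * \<i> * PP x * rr 0 x * cnj u - 8 * \<i> * PP x * ss 1 x * cnj u + 4 * \<i> * PP x * u * cnj u^2
      - 2 * PP x * cnj ux + 16 * \<i> * pp 1 x * qq 0 x - 8 * \<i> * pp 1 x * cnj u
      - 8 * \<i> * qq 0 x * ss 1 x * u - 4 * \<i> * qq 0 x * u^2 * cnj u - 2 * qq 0 x * ux
      + 8 * \<i> * qq 1 x * u)) (at x)"
  unfolding at.gg_def
  by (rule has_vector_derivative_eq_rhs[OF has_vector_derivative_diff[OF has_vector_derivative_const
      brackets_deriv_t(2)[OF assms]]])
     (simp only: pp_0', algebra)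

text \<open>After \<open>brk_Suc_E\<close> the terms free of \<open>hh\<close> cancel, and the
  remaining cofactor is exactly the logarithmic derivative of \<open>gg\<close>.\<close>

lemma hh_deriv_x:
  assumes "flow_x u x"
  shows "((\<lambda>s. hh s) has_vector_derivative hh x * (4 * \<i> * PP x * qq 0 x - 2 * \<i> * PP x * cnj u
      + 2 * \<i> * qq 0 x * u)) (at x)"
proof -
  note A = assms[unfolded flow_x_def, THEN conjunct1] and B = assms[unfolded flow_x_def, THEN
      conjunct2]
  note ab = vder_ra_rb[OF A B, of 0, unfolded row_simps]
  show ?thesis
    unfolding at.hh_def
    by (rule has_vector_derivative_eq_rhs[OF has_vector_derivative_add[OF
        has_vector_derivative_const
          brk_flow_x[OF assms ab(1) vder_E[OF A]]]])
       (simp add: dg_add dg_diff dg_minus dg_smult dg_inverse brk_atoms brk_ra_0_E at.brk_Suc_E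
           at.brk_rb_1_E pp_0' at.E_def[symmetric],
        simp add: algebra_simps)
qed

lemma hh_deriv_t:
  assumes "flow_t u ux x"
  shows "((\<lambda>s. hh s) has_vector_derivative hh x * (-16 * \<i> * PP x * qq 0 x * rr 0 x
      - 8 * \<i> * PP x * qq 0 x * u * cnj u + 8 * \<i> * PP x * qq 0 x^2 * u + 16 * \<i> * PP x * qq 1 x
      + 8 * \<i> * PP x * rr 0 x * cnj u - 8 * \<i> * PP x * ss 1 x * cnj u + 4 * \<i> * PP x * u * cnj u^2
      - 2 * PP x * cnj ux + 16 * \<i> * pp 1 x * qq 0 x - 8 * \<i> * pp 1 x * cnj u
      - 8 * \<i> * qq 0 x * ss 1 x * u - 4 * \<i> * qq 0 x * u^2 * cnj u - 2 * qq 0 x * ux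
      + 8 * \<i> * qq 1 x * u)) (at x)"
proof -
  note A = assms[unfolded flow_t_def, THEN conjunct1] and B = assms[unfolded flow_t_def, THEN
      conjunct2]
  note ab = vder_ra_rb[OF A B, of 0, unfolded row_simps]
  show ?thesis
    unfolding at.hh_def
    by (rule has_vector_derivative_eq_rhs[OF has_vector_derivative_add[OF
        has_vector_derivative_const
          brk_flow_t[OF assms ab(1) vder_E[OF A]]]])
       (simp add: dg_add dg_diff dg_minus dg_smult dg_inverse brk_atoms brk_ra_0_E at.brk_Suc_E
           at.brk_rb_1_E pp_0' at.E_def[symmetric] numeral_2_eq_2,
        simp add: algebra_simps power2_eq_square)
qed

text \<open>Differentiability of \<open>PP\<close> comes from its definition, the value of the derivative
  from \<open>pp 0 = gg * PP\<close>; this avoids conjugating the derivative of \<open>qq 0\<close>.\<close>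

lemma PP_deriv_x:
  assumes "flow_x u x"
  shows "((\<lambda>s. PP s) has_vector_derivative -4 * \<i> * PP x * qq 0 x * u - 4 * \<i> * PP x^2 * qq 0 x
      + 2 * \<i> * PP x^2 * cnj u - 4 * \<i> * pp 1 x - 2 * \<i> * rr 0 x * u + 2 * \<i> * ss 1 x * u) (at x)"
proof (rule has_vector_derivative_cofactor[OF _ gg_deriv_x[OF assms] brackets_deriv_x(3)[OF assms,
    of 0, unfolded at.pp_0]])
  show "(\<lambda>s. PP s) differentiable at x"
    unfolding at.PP_def
    using differentiableI_vector[OF brackets_deriv_x(2)[OF assms, of 0]] by
        (simp add: differentiable_cnj_iff)
qed (simp_all only: One_nat_def pp_0' at.gg_def at.gg_nz[unfolded at.gg_def], algebra, simp)

lemma PP_deriv_t: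
  assumes "flow_t u ux x"
  shows "((\<lambda>s. PP s) has_vector_derivative -32 * \<i> * PP x * pp 1 x * qq 0 x
      + 16 * \<i> * PP x * pp 1 x * cnj u + 16 * \<i> * PP x * qq 0 x * ss 1 x * u
      + 8 * \<i> * PP x * qq 0 x * u^2 * cnj u + 4 * PP x * qq 0 x * ux - 16 * \<i> * PP x * qq 1 x * u
      + 16 * \<i> * PP x^2 * qq 0 x * rr 0 x + 8 * \<i> * PP x^2 * qq 0 x * u * cnj u
      - 8 * \<i> * PP x^2 * qq 0 x^2 * u - 16 * \<i> * PP x^2 * qq 1 x - 8 * \<i> * PP x^2 * rr 0 x * cnj u
      + 8 * \<i> * PP x^2 * ss 1 x * cnj u - 4 * \<i> * PP x^2 * u * cnj u^2 + 2 * PP x^2 * cnj ux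
      - 8 * \<i> * pp 1 x * qq 0 x * u + 16 * \<i> * pp 1 x * ss 1 x + 8 * \<i> * pp 1 x * u * cnj u
      - 16 * \<i> * pp 2 x + 8 * \<i> * rr 0 x * ss 1 x * u + 4 * \<i> * rr 0 x * u^2 * cnj u
      + 2 * rr 0 x * ux - 8 * \<i> * rr 1 x * u - 4 * \<i> * ss 1 x * u^2 * cnj u - 2 * ss 1 x * ux
      - 8 * \<i> * ss 1 x^2 * u + 8 * \<i> * ss 2 x * u) (at x)"
proof (rule has_vector_derivative_cofactor[OF _ gg_deriv_t[OF assms] brackets_deriv_t(1)[OF assms,
    unfolded at.pp_0]])
  show "(\<lambda>s. PP s) differentiable at x"
    unfolding at.PP_def
    using brackets_deriv_t(3)[OF assms] by (auto dest: differentiableI_vector simp: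
        differentiable_cnj_iff)
qed (simp_all only: One_nat_def pp_0' at.gg_def at.gg_nz[unfolded at.gg_def], algebra, simp)

end

section \<open>The polynomial identity behind the equation\<close>

text \<open>The terms are named as in \<open>brackets_deriv_x\<close>: \<open>ra\<close>, \<open>rb\<close> are \<open>rr 0\<close>, \<open>rr 1\<close>; \<open>qa\<close> is \<open>qq 1\<close>;
  \<open>pa\<close>, \<open>pb\<close> are \<open>pp 1\<close>, \<open>pp 2\<close>; \<open>sa\<close>, \<open>sb\<close> are \<open>ss 1\<close>, \<open>ss 2\<close>. The terms \<open>rb\<close>, \<open>pb\<close>, \<open>sb\<close>
  already cancel in \<open>I * Pt + Pxx\<close>.\<close>

lemma dnls_identity:
  fixes I :: complex
  assumes I: "I * I = -1"
    and Px: "Px = -4 * I * P * q * u - 4 * I * P^2 * q + 2 * I * P^2 * ub - 4 * I * pa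
        - 2 * I * ra * u + 2 * I * sa * u"
    and Pt: "Pt = -32 * I * P * pa * q + 16 * I * P * pa * ub + 16 * I * P * q * sa * u
        + 8 * I * P * q * u^2 * ub + 4 * P * q * ux - 16 * I * P * qa * u + 16 * I * P^2 * q * ra
        + 8 * I * P^2 * q * u * ub - 8 * I * P^2 * q^2 * u - 16 * I * P^2 * qa
        - 8 * I * P^2 * ra * ub + 8 * I * P^2 * sa * ub - 4 * I * P^2 * u * ub^2 + 2 * P^2 * ubx
        - 8 * I * pa * q * u + 16 * I * pa * sa + 8 * I * pa * u * ub - 16 * I * pb
        + 8 * I * ra * sa * u + 4 * I * ra * u^2 * ub + 2 * ra * ux - 8 * I * rb * u
        - 4 * I * sa * u^2 * ub - 2 * sa * ux - 8 * I * sa^2 * u + 8 * I * sb * u"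
    and Pxx: "Pxx = -32 * P * pa * q + 16 * P * pa * ub - 32 * P * q * ra * u + 16 * P * q * sa * u
        - 4 * I * P * q * ux - 8 * P * q^2 * u^2 + 16 * P * qa * u + 16 * P * ra * u * ub
        - 16 * P * sa * u * ub - 16 * P^2 * q * ra + 24 * P^2 * q * u * ub - 40 * P^2 * q^2 * u
        + 16 * P^2 * qa + 8 * P^2 * ra * ub - 8 * P^2 * sa * ub + 2 * I * P^2 * ubx
        + 32 * P^3 * q * ub - 32 * P^3 * q^2 - 8 * P^3 * ub^2 - 8 * pa * q * u + 16 * pa * sa
        - 8 * pa * u * ub - 16 * pb - 8 * q * ra * u^2 + 8 * qa * u^2 + 8 * ra * sa * u
        - 2 * I * ra * ux - 8 * rb * u + 2 * I * sa * ux - 8 * sa^2 * u + 8 * sb * u"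
    and qx: "qx = -4 * I * q * ra + 2 * I * q^2 * u + 4 * I * qa + 2 * I * ra * ub
        - 2 * I * sa * ub"
    and M: "M = -16 * I * P * q * ra - 8 * I * P * q * u * ub + 8 * I * P * q^2 * u
        + 16 * I * P * qa + 8 * I * P * ra * ub - 8 * I * P * sa * ub + 4 * I * P * u * ub^2
        - 2 * P * ubx + 16 * I * pa * q - 8 * I * pa * ub - 8 * I * q * sa * u
        - 4 * I * q * u^2 * ub - 2 * q * ux + 8 * I * qa * u"
    and L: "L = 4 * I * P * q - 2 * I * P * ub + 2 * I * q * u"
    and Lx: "Lx = 4 * I * (Px * q + P * qx) - 2 * I * (Px * ub + P * ubx) + 2 * I * (qx * u
        + q * ux)"
    and v: "v = u + 2 * P" and w: "w = ub - 2 * q"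
    and vx: "vx = ux + 2 * Px" and wx: "wx = ubx - 2 * qx"
    and dnls: "I * ut + uxx + 2 * I * ((ux * ub + u * ubx) * u + u * ub * ux) = 0"
  shows "I * (2 * M * v + (ut + 2 * Pt)) + (2 * L * (2 * L * v + vx) + (2 * Lx * v + 2 * L * vx
      + (uxx + 2 * Pxx)))
    + 2 * I * (2 * L * (v * w * v) + ((vx * w + v * wx) * v + v * w * vx)) = 0"
proof -
  have 1: "I * Pt + Pxx = -32 * P * q * ra * u - 8 * P * q * u^2 * ub - 8 * P * q^2 * u^2
      + 32 * P * qa * u + 16 * P * ra * u * ub - 16 * P * sa * u * ub - 32 * P^2 * q * ra
      + 16 * P^2 * q * u * ub - 32 * P^2 * q^2 * u + 32 * P^2 * qa + 16 * P^2 * ra * ub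
      - 16 * P^2 * sa * ub + 4 * P^2 * u * ub^2 + 4 * I * P^2 * ubx + 32 * P^3 * q * ub
      - 32 * P^3 * q^2 - 8 * P^3 * ub^2 - 16 * pa * u * ub - 8 * q * ra * u^2 + 8 * qa * u^2
      - 4 * ra * u^2 * ub + 4 * sa * u^2 * ub"
    unfolding Pt Pxx using I by algebra
  have 2: "I * M = 16 * P * q * ra + 8 * P * q * u * ub - 8 * P * q^2 * u - 16 * P * qa
      - 8 * P * ra * ub + 8 * P * sa * ub - 4 * P * u * ub^2 - 2 * I * P * ubx - 16 * pa * q
      + 8 * pa * ub + 8 * q * sa * u + 4 * q * u^2 * ub - 2 * I * q * ux - 8 * qa * u"
    unfolding M using I by algebra
  \<comment> \<open>The goal contains \<open>ut\<close> and \<open>uxx\<close> only in the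
    combination \<open>I * ut + uxx\<close>, so the equation for \<open>u\<close> removes both at
    once.\<close>
  have uxx: "uxx = - I * ut - 2 * I * ((ux * ub + u * ubx) * u + u * ub * ux)"
    using dnls by algebra
  have "2 * (I * M) * v + 2 * (I * Pt + Pxx) + 4 * L * L * v + 4 * L * vx + 2 * Lx * v
    + 2 * I * (2 * L * (v * w * v) + ((vx * w + v * wx) * v + v * w * vx)) - 2 * I * ((ux * ub
        + u * ubx) * u + u * ub * ux) = 0"
    unfolding 1 2 Lx L v w vx wx Px qx using I by algebra
  then show ?thesis
    using uxx by algebra
qed

context cauchy_curve
begin

text \<open>The function differentiated is the right-hand side of \<open>PP_deriv_x\<close>, with
  squares written as products so that the product rule applies to them directly.\<close>

lemma PP_deriv_xx:
  assumes f: "flow_x (u x) x" and u: "(u has_vector_derivative ux) (at x)"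
  shows "((\<lambda>s. - 4 * \<i> * PP s * qq 0 s * u s - 4 * \<i> * (PP s * PP s) * qq 0 s
      + 2 * \<i> * (PP s * PP s) * cnj (u s) - 4 * \<i> * pp (Suc 0) s - 2 * \<i> * rr 0 s * u s
          + 2 * \<i> * ss (Suc 0) s * u s)
    has_vector_derivative -32 * PP x * pp (Suc 0) x * qq 0 x + 16 * PP x * pp (Suc 0) x * cnj (u x)
        - 32 * PP x * qq 0 x * rr 0 x * u x + 16 * PP x * qq 0 x * ss (Suc 0) x * u x
        - 4 * \<i> * PP x * qq 0 x * ux - 8 * PP x * qq 0 x^2 * u x^2 + 16 * PP x * qq (Suc 0) x * u x
        + 16 * PP x * rr 0 x * u x * cnj (u x) - 16 * PP x * ss (Suc 0) x * u x * cnj (u x)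
        - 16 * PP x^2 * qq 0 x * rr 0 x + 24 * PP x^2 * qq 0 x * u x * cnj (u x)
        - 40 * PP x^2 * qq 0 x^2 * u x + 16 * PP x^2 * qq (Suc 0) x
        + 8 * PP x^2 * rr 0 x * cnj (u x) - 8 * PP x^2 * ss (Suc 0) x * cnj (u x)
        + 2 * \<i> * PP x^2 * cnj ux + 32 * PP x^3 * qq 0 x * cnj (u x) - 32 * PP x^3 * qq 0 x^2
        - 8 * PP x^3 * cnj (u x)^2 - 8 * pp (Suc 0) x * qq 0 x * u x
        + 16 * pp (Suc 0) x * ss (Suc 0) x - 8 * pp (Suc 0) x * u x * cnj (u x)
        - 16 * pp (Suc (Suc 0)) x - 8 * qq 0 x * rr 0 x * u x^2 + 8 * qq (Suc 0) x * u x^2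
        + 8 * rr 0 x * ss (Suc 0) x * u x - 2 * \<i> * rr 0 x * ux - 8 * rr (Suc 0) x * u x
        + 2 * \<i> * ss (Suc 0) x * ux - 8 * ss (Suc 0) x^2 * u x
        + 8 * ss (Suc (Suc 0)) x * u x) (at x)"
proof -
  note S = brackets_deriv_x[OF f, unfolded One_nat_def]
  \<comment> \<open>For \<open>algebra\<close> the imaginary unit is an indeterminate, so its square
    is supplied as a fact.\<close>
  have i: "\<i> * \<i> = -1" by simp
  show ?thesis
    using i by - (rule has_vector_derivative_eq_rhs,
        (rule has_vector_derivative_add has_vector_derivative_diff S PP_deriv_x[OF f, unfolded
            One_nat_def] u
          has_vector_derivative_mult has_vector_derivative_cnj has_vector_derivative_const)+,
        algebra)
qed

end

section \<open>From the matrix M of the theorem to the Cauchy-like matrix\<close>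

lemma cdot_bil: "cdot v w = bil (conjv v) w"
  by (simp add: cdot_def bil_def)

lemma ctrans_Lam_vec: "ctrans (Lam lam) *v y = dg (\<lambda>i. cnj (lam i)) y"
proof -
  have "cnj (if j = i then lam j else 0) * y $ j = (if j = i then cnj (lam i) * y $ i else 0)" for i
      j
    by simp
  then show ?thesis
    by (simp add: vec_eq_iff matrix_vector_mult_def ctrans_def Lam_def)
qed

lemma ctrans_mult: "ctrans (M ** N) = ctrans N ** ctrans M"
  by (simp add: ctrans_def matrix_matrix_mult_def vec_eq_iff mult.commute)

lemma ctrans_mat_1: "ctrans (mat 1) = mat 1"
  by (simp add: ctrans_def mat_def vec_eq_iff)

lemma invertible_ctrans: "invertible M \<Longrightarrow> invertible (ctrans M)"
  unfolding invertible_def by (metis ctrans_mult ctrans_mat_1)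

context
  fixes lam :: "'n::finite \<Rightarrow> complex" and ph :: "'n \<Rightarrow> complex^2"
    and z :: "'n \<Rightarrow> complex" and A B :: "complex^'n"
  defines "z \<equiv> \<lambda>i. lam i ^ 2"
    and "A \<equiv> \<chi> i. lam i * ph i $ 1"
    and "B \<equiv> \<chi> i. ph i $ 2"
  assumes lam: "\<And>i j. cnj (lam j) \<noteq> lam i \<and> cnj (lam j) \<noteq> - lam i"
begin

lemma lam_nz: "lam i \<noteq> 0"
  using lam[of i i] by auto

text \<open>Equal squares agree up to sign, and both signs are excluded.\<close>

lemma lam_sq_sep: "cnj (z j) \<noteq> z i"
  using lam[of j i] by (simp add: z_def power2_eq_iff)

text \<open>Over the common denominator z_j' - z_i the two fractions combine: the first components
  of the eigenfunctions keep the factor 2 lambda_i and the second ones 2 lambda_j'. Multiplication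
  by lambda_i lambda_j' then produces A and z_j'.\<close>

lemma Mmat_nth: "Mmat lam ph $ i $ j = 2 * lam i * cauchy_mat z A B $ i $ j"
proof -
  have nz: "cnj (lam j) - lam i \<noteq> 0" "cnj (lam j) + lam i \<noteq> 0"
    using lam[of j i] by (auto simp: add_eq_0_iff2)
  have d: "cnj (z j) - z i = (cnj (lam j) - lam i) * (cnj (lam j) + lam i)"
    by (simp add: z_def power2_eq_square algebra_simps)
  show ?thesis
    using nz by (simp add: Mmat_def cauchy_mat_def d cdot_def sum_2 sigma3_def
        matrix_vector_mult_def A_def B_def)
       (simp add: z_def field_simps power2_eq_square)
qed

lemma Mmat_vec: "Mmat lam ph *v y = dg (\<lambda>i. 2 * lam i) (cauchy_mat z A B *v y)"
  by (simp add: vec_eq_iff matrix_vector_mult_def Mmat_nth sum_distrib_left mult_ac)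

lemma invertible_cauchy_mat:
  assumes "invertible (Mmat lam ph)"
  shows "invertible (cauchy_mat z A B)"
proof -
  have "y = 0" if "cauchy_mat z A B *v y = 0" for y
  proof -
    have "Mmat lam ph *v y = 0"
      by (simp add: Mmat_vec that) (simp add: vec_eq_iff)
    then show ?thesis
      using matrix_inv_vec(2)[OF assms, of y] by simp
  qed
  then show ?thesis
    by (metis invertible_left_inverse matrix_left_invertible_ker)
qed

text \<open>The two numerators become \<open>hh\<close> and 2 \<open>PP * hh\<close>, after u is
  split off, while the denominator becomes cnj gg.\<close>

lemma uN_eq:
  assumes Minv: "invertible (Mmat lam ph)"
  shows "uN lam ph a = cauchy.gg z A B * cauchy.hh z A B * (a + 2 * cauchy.PP z A B)"
proof -
  interpret cauchy z A B
    by unfold_locales (use lam_sq_sep invertible_cauchy_mat[OF Minv] in auto)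
  let ?M = "Mmat lam ph" and ?p1 = "\<chi> i. ph i $ 1" and ?L = "ctrans (Lam lam)"
  let ?cl = "\<lambda>i. cnj (lam i)"
  \<comment> \<open>Here phi^(1) = Lam E and M = 2 Lam K, so the factor Lam cancels.\<close>
  have y: "matrix_inv ?M *v ?p1 = (1/2) *s (matrix_inv K *v E)"
    by (rule matrix_inv_vec_eqI[OF Minv])
       (simp add: Mmat_vec matrix_vector_mult_smult matrix_inv_vec inv E_def,
        simp add: vec_eq_iff A_def z_def lam_nz power2_eq_square)
  have 1: "2 * cdot ?p1 ((?L ** matrix_inv ?M) *v ?p1) = hh - 1"
  proof -
    have "dg ?cl (conjv ?p1) = ac"
      by (simp add: vec_eq_iff A_def)
    then show ?thesis
      by (simp add: matrix_vector_mul_assoc[symmetric] y ctrans_Lam_vec cdot_bil bil_dg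
          bil_smult_right
        hh_def ra_0 brk_def)
  qed
  have 2: "2 * cdot B ((?L ** ?L ** matrix_inv ?M) *v ?p1) = PP * hh"
  proof -
    \<comment> \<open>Two conjugated factors lambda make one conjugated z, so
      \<open>brk_rb_1_E\<close> becomes applicable.\<close>
    have "dg ?cl (dg ?cl bc) = rb (Suc 0)"
      unfolding rb_def by (simp add: vec_eq_iff z_def power2_eq_square)
    then show ?thesis
      by (simp add: matrix_vector_mul_assoc[symmetric] y ctrans_Lam_vec cdot_bil bil_dg
          bil_smult_right
        brk_rb_1_E[symmetric] brk_def)
  qed
  \<comment> \<open>The conjugate transpose of M is moved across the pairing: with M' y = B and K w
    = B, the number y' M w is both \<open>ss 0\<close> and y' applied to 2 Lam B.\<close>
  have 3: "2 * cdot B ((?L ** matrix_inv (ctrans ?M)) *v B) = cnj (ss 0)"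
  proof -
    define y w where "y = matrix_inv (ctrans ?M) *v B" and "w = matrix_inv K *v B"
    have My: "ctrans ?M *v y = B" and Kw: "K *v w = B"
      by (simp_all add: y_def w_def matrix_inv_vec invertible_ctrans Minv inv)
    have "ss 0 = bil (conjv (ctrans ?M *v y)) w"
      by (simp add: ss_def rb_0 brk_def w_def My)
    also have "\<dots> = (\<Sum>i\<in>UNIV. \<Sum>j\<in>UNIV. ?M $ j $ i * cnj (y $ j) * w $ i)"
      by (simp add: bil_def matrix_vector_mult_def ctrans_def sum_distrib_right)
    also have "\<dots> = (\<Sum>j\<in>UNIV. \<Sum>i\<in>UNIV. ?M $ j $ i * cnj (y $ j) * w $ i)"
      by (rule sum.swap)
    also have "\<dots> = bil (conjv y) (?M *v w)"
      by (simp add: bil_def matrix_vector_mult_def sum_distrib_left mult_ac)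
    also have "\<dots> = bil (conjv y) (dg (\<lambda>i. 2 * lam i) B)"
      by (simp add: Mmat_vec Kw)
    also have "cnj \<dots> = 2 * cdot B (dg ?cl y)"
      by (simp add: bil_def cdot_def sum_distrib_left mult_ac)
    finally show ?thesis
      by (simp add: matrix_vector_mul_assoc[symmetric] ctrans_Lam_vec y_def)
  qed
  have "uN lam ph a = (1 + 2 * cdot ?p1 ((?L ** matrix_inv ?M) *v ?p1))
      / (1 - 2 * cdot B ((?L ** matrix_inv (ctrans ?M)) *v B)) * a
    + 2 * (2 * cdot B ((?L ** ?L ** matrix_inv ?M) *v ?p1)) / (1
        - 2 * cdot B ((?L ** matrix_inv (ctrans ?M)) *v B))"
    by (simp add: uN_def Let_def B_def)
  also have "\<dots> = hh / cnj gg * a + 2 * (PP * hh) / cnj gg"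
    unfolding 1 2 3 by (simp add: gg_def)
  \<comment> \<open>Since |gg| = 1, the denominator turns into a factor.\<close>
  also have "1 / cnj gg = gg"
    using gg_unit gg_nz by (simp add: field_simps)
  then have "hh / cnj gg * a + 2 * (PP * hh) / cnj gg = gg * hh * (a + 2 * PP)"
    by (simp add: divide_inverse algebra_simps)
  finally show ?thesis .
qed

end

section \<open>The dressed field solves the equation\<close>

lemma cauchy_curve_mat: "cauchy_curve z A B \<Longrightarrow> cauchy z (A s) (B s)"
  by (simp add: cauchy_curve_def cauchy_def)

text \<open>Write the field as U = G V with G = \<open>gg * hh\<close> and V = u + 2 P. Every term
  of the equation for U is G times an expression in V and the logarithmic derivatives of G, so
  \<open>dnls_identity\<close> remains.\<close>

lemma dnls_dressing:
  fixes u :: "real \<Rightarrow> real \<Rightarrow> complex" and A B :: "real \<Rightarrow> real \<Rightarrow> complex^'n::finite"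
  assumes X: "\<And>t. cauchy_curve z (\<lambda>s. A s t) (\<lambda>s. B s t)"
    and T: "\<And>x. cauchy_curve z (A x) (B x)"
    and fx: "\<And>x t. cauchy_curve.flow_x z (\<lambda>s. A s t) (\<lambda>s. B s t) (u x t) x"
    and ft: "\<And>x t. cauchy_curve.flow_t z (A x) (B x) (u x t) (px u x t) t"
    and sol: "dnls_solution u"
  shows "dnls_solution (\<lambda>x t. cauchy.gg z (A x t) (B x t) * cauchy.hh z (A x t) (B x t)
    * (u x t + 2 * cauchy.PP z (A x t) (B x t)))"
proof -
  define P where "P = (\<lambda>x t. cauchy.PP z (A x t) (B x t))"
  define g where "g = (\<lambda>x t. cauchy.gg z (A x t) (B x t))"
  define h where "h = (\<lambda>x t. cauchy.hh z (A x t) (B x t))"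
  define r where "r = (\<lambda>k x t. cauchy.rr z (A x t) (B x t) k)"
  define q where "q = (\<lambda>k x t. cauchy.qq z (A x t) (B x t) k)"
  define p where "p = (\<lambda>k x t. cauchy.pp z (A x t) (B x t) k)"
  define s where "s = (\<lambda>k x t. cauchy.ss z (A x t) (B x t) k)"
  note defs = P_def g_def h_def r_def q_def p_def s_def
  define ux uxx ut where "ux = px u" and "uxx = px (px u)" and "ut = pt u"
  note du = sol[unfolded dnls_solution_def, rule_format]
  have dux: "((\<lambda>s. u s t) has_vector_derivative ux x t) (at x)" for x t
    using du[of t x] by (simp add: vector_derivative_works ux_def px_def)
  have duxx: "((\<lambda>s. ux s t) has_vector_derivative uxx x t) (at x)" for x t
    using du[of t x] by (simp add: vector_derivative_works ux_def uxx_def px_def[of "px u"])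
  have dut: "((\<lambda>\<tau>. u x \<tau>) has_vector_derivative ut x t) (at t)" for x t
    using du[of t x] by (simp add: vector_derivative_works ut_def pt_def)
  have sq: "complex_of_real ((cmod c)\<^sup>2) = c * cnj c" for c
    by (simp only: complex_norm_square)
  have eq_u: "\<i> * ut x t + uxx x t + 2 * \<i> * ((ux x t * cnj (u x t) + u x t * cnj (ux x t)) * u x t
      + u x t * cnj (u x t) * ux x t) = 0" for x t
  proof -
    have "((\<lambda>y. u y t * cnj (u y t) * u y t) has_vector_derivative
        (u x t * cnj (u x t) * ux x t + (u x t * cnj (ux x t)
            + ux x t * cnj (u x t)) * u x t)) (at x)"
      by (intro has_vector_derivative_mult has_vector_derivative_cnj dux)
    then have "px (\<lambda>y \<tau>. complex_of_real ((cmod (u y \<tau>))\<^sup>2) * u y \<tau>) x t =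
        u x t * cnj (u x t) * ux x t + (u x t * cnj (ux x t) + ux x t * cnj (u x t)) * u x t"
      by (simp only: px_def sq vector_derivative_at)
    then show ?thesis
      using du[of t x] by (simp add: ut_def uxx_def ux_def algebra_simps)
  qed
  \<comment> \<open>These abbreviations reproduce the right-hand sides of the derivative lemmas as
    functions of both variables, so that \<open>Px\<close> can be differentiated again in x.\<close>
  define Px where "Px = (\<lambda>x t. -4 * \<i> * P x t * q 0 x t * u x t - 4 * \<i> * (P x t * P x t) * q 0 x t
      + 2 * \<i> * (P x t * P x t) * cnj (u x t) - 4 * \<i> * p 1 x t - 2 * \<i> * r 0 x t * u x t
      + 2 * \<i> * s 1 x t * u x t)"
  define Pt where "Pt = (\<lambda>x t. -32 * \<i> * P x t * p 1 x t * q 0 x t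
      + 16 * \<i> * P x t * p 1 x t * cnj (u x t) + 16 * \<i> * P x t * q 0 x t * s 1 x t * u x t
      + 8 * \<i> * P x t * q 0 x t * (u x t)^2 * cnj (u x t) + 4 * P x t * q 0 x t * ux x t
      - 16 * \<i> * P x t * q 1 x t * u x t + 16 * \<i> * (P x t * P x t) * q 0 x t * r 0 x t
      + 8 * \<i> * (P x t * P x t) * q 0 x t * u x t * cnj (u x t)
      - 8 * \<i> * (P x t * P x t) * (q 0 x t)^2 * u x t - 16 * \<i> * (P x t * P x t) * q 1 x t
      - 8 * \<i> * (P x t * P x t) * r 0 x t * cnj (u x t)
      + 8 * \<i> * (P x t * P x t) * s 1 x t * cnj (u x t)
      - 4 * \<i> * (P x t * P x t) * u x t * cnj (u x t)^2 + 2 * (P x t * P x t) * cnj (ux x t)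
      - 8 * \<i> * p 1 x t * q 0 x t * u x t + 16 * \<i> * p 1 x t * s 1 x t
      + 8 * \<i> * p 1 x t * u x t * cnj (u x t) - 16 * \<i> * p 2 x t + 8 * \<i> * r 0 x t * s 1 x t * u x t
      + 4 * \<i> * r 0 x t * (u x t)^2 * cnj (u x t) + 2 * r 0 x t * ux x t - 8 * \<i> * r 1 x t * u x t
      - 4 * \<i> * s 1 x t * (u x t)^2 * cnj (u x t) - 2 * s 1 x t * ux x t
      - 8 * \<i> * (s 1 x t)^2 * u x t + 8 * \<i> * s 2 x t * u x t)"
  define Pxx where "Pxx = (\<lambda>x t. -32 * P x t * p 1 x t * q 0 x t
      + 16 * P x t * p 1 x t * cnj (u x t) - 32 * P x t * q 0 x t * r 0 x t * u x t
      + 16 * P x t * q 0 x t * s 1 x t * u x t - 4 * \<i> * P x t * q 0 x t * ux x t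
      - 8 * P x t * (q 0 x t)^2 * (u x t)^2 + 16 * P x t * q 1 x t * u x t
      + 16 * P x t * r 0 x t * u x t * cnj (u x t) - 16 * P x t * s 1 x t * u x t * cnj (u x t)
      - 16 * (P x t * P x t) * q 0 x t * r 0 x t + 24 * (P x t * P x t) * q 0 x t * u x t * cnj (u x
      t) - 40 * (P x t * P x t) * (q 0 x t)^2 * u x t + 16 * (P x t * P x t) * q 1 x t
      + 8 * (P x t * P x t) * r 0 x t * cnj (u x t) - 8 * (P x t * P x t) * s 1 x t * cnj (u x t)
      + 2 * \<i> * (P x t * P x t) * cnj (ux x t) + 32 * (P x t)^3 * q 0 x t * cnj (u x t)
      - 32 * (P x t)^3 * (q 0 x t)^2 - 8 * (P x t)^3 * cnj (u x t)^2 - 8 * p 1 x t * q 0 x t * u x t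
      + 16 * p 1 x t * s 1 x t - 8 * p 1 x t * u x t * cnj (u x t) - 16 * p 2 x t
      - 8 * q 0 x t * r 0 x t * (u x t)^2 + 8 * q 1 x t * (u x t)^2 + 8 * r 0 x t * s 1 x t * u x t
      - 2 * \<i> * r 0 x t * ux x t - 8 * r 1 x t * u x t + 2 * \<i> * s 1 x t * ux x t
      - 8 * (s 1 x t)^2 * u x t + 8 * s 2 x t * u x t)"
  define L where "L = (\<lambda>x t. 4 * \<i> * P x t * q 0 x t - 2 * \<i> * P x t * cnj (u x t)
      + 2 * \<i> * q 0 x t * u x t)"
  define M where "M = (\<lambda>x t. -16 * \<i> * P x t * q 0 x t * r 0 x t
      - 8 * \<i> * P x t * q 0 x t * u x t * cnj (u x t) + 8 * \<i> * P x t * (q 0 x t)^2 * u x t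
      + 16 * \<i> * P x t * q 1 x t + 8 * \<i> * P x t * r 0 x t * cnj (u x t)
      - 8 * \<i> * P x t * s 1 x t * cnj (u x t) + 4 * \<i> * P x t * u x t * cnj (u x t)^2
      - 2 * P x t * cnj (ux x t) + 16 * \<i> * p 1 x t * q 0 x t - 8 * \<i> * p 1 x t * cnj (u x t)
      - 8 * \<i> * q 0 x t * s 1 x t * u x t - 4 * \<i> * q 0 x t * (u x t)^2 * cnj (u x t)
      - 2 * q 0 x t * ux x t + 8 * \<i> * q 1 x t * u x t)"
  define qx where "qx = (\<lambda>x t. -4 * \<i> * q 0 x t * r 0 x t + 2 * \<i> * (q 0 x t)^2 * u x t
      + 4 * \<i> * q 1 x t + 2 * \<i> * r 0 x t * cnj (u x t) - 2 * \<i> * s 1 x t * cnj (u x t))"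
  \<comment> \<open>Through this relation the conjugate of V is cnj u - 2 q 0, and its x-derivative
    is obtained from \<open>qx\<close> instead of by conjugating \<open>Px\<close>.\<close>
  have Pq: "cnj (P x t) = - q 0 x t" for x t
    by (simp add: P_def q_def cauchy.PP_def[OF cauchy_curve_mat[OF T]])
  have dP: "((\<lambda>s. P s t) has_vector_derivative Px x t) (at x)" for x t
    using cauchy_curve.PP_deriv_x[OF X fx, of t x] by (simp only: Px_def defs power2_eq_square)
  have dPt: "((\<lambda>\<tau>. P x \<tau>) has_vector_derivative Pt x t) (at t)" for x t
    using cauchy_curve.PP_deriv_t[OF T ft, of x t] by
        (simp only: Pt_def defs power2_eq_square ux_def)
  have dPx: "((\<lambda>s. Px s t) has_vector_derivative Pxx x t) (at x)" for x t
    using cauchy_curve.PP_deriv_xx[OF X fx dux, of t x]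
    by (simp only: Px_def Pxx_def defs power2_eq_square One_nat_def[symmetric] Suc_1)
  have dq: "((\<lambda>s. q 0 s t) has_vector_derivative qx x t) (at x)" for x t
    using cauchy_curve.brackets_deriv_x(2)[OF X fx, of t 0 x] by
        (simp add: qx_def defs algebra_simps power2_eq_square)
  define G V Vx Vb Vbx where "G = (\<lambda>x t. g x t * h x t)"
    and "V = (\<lambda>x t. u x t + 2 * P x t)" and "Vx = (\<lambda>x t. ux x t + 2 * Px x t)"
    and "Vb = (\<lambda>x t. cnj (u x t) - 2 * q 0 x t)" and "Vbx = (\<lambda>x t. cnj (ux x t) - 2 * qx x t)"
  \<comment> \<open>Both factors of G have the logarithmic derivative L, hence the coefficient
    2.\<close>
  have dG: "((\<lambda>s. G s t) has_vector_derivative G x t * (2 * L x t)) (at x)" for x t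
  proof -
    have "((\<lambda>s. g s t) has_vector_derivative g x t * L x t) (at x)"
      "((\<lambda>s. h s t) has_vector_derivative h x t * L x t) (at x)"
      using cauchy_curve.gg_deriv_x[OF X fx, of t x] cauchy_curve.hh_deriv_x[OF X fx, of t x]
      by (simp_all only: defs L_def)
    from has_vector_derivative_mult[OF this] show ?thesis
      unfolding G_def by (rule has_vector_derivative_eq_rhs) (simp add: algebra_simps)
  qed
  have dGt: "((\<lambda>\<tau>. G x \<tau>) has_vector_derivative G x t * (2 * M x t)) (at t)" for x t
  proof -
    have "((\<lambda>\<tau>. g x \<tau>) has_vector_derivative g x t * M x t) (at t)"
      "((\<lambda>\<tau>. h x \<tau>) has_vector_derivative h x t * M x t) (at t)"
      using cauchy_curve.gg_deriv_t[OF T ft, of x t] cauchy_curve.hh_deriv_t[OF T ft, of x t]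
      by (simp_all only: defs M_def ux_def power2_eq_square)
    from has_vector_derivative_mult[OF this] show ?thesis
      unfolding G_def by (rule has_vector_derivative_eq_rhs) (simp add: algebra_simps)
  qed
  have G1: "G x t * cnj (G x t) = 1" for x t
    using cauchy.gg_unit[OF cauchy_curve_mat[OF T], of x t] cauchy.hh_unit[OF cauchy_curve_mat[OF
        T], of x t]
    by (simp add: G_def defs) (metis mult.assoc mult.left_commute mult.right_neutral)
  have cV: "cnj (V x t) = Vb x t" for x t
    by (simp add: V_def Vb_def Pq)
  have const2: "((\<lambda>s. 2 * f s) has_vector_derivative 2 * f') (at y)"
    if "(f has_vector_derivative f') (at y)" for f :: "real \<Rightarrow> complex" and f' y
    using that by (rule has_vector_derivative_mult_right)
  have dV: "((\<lambda>s. V s t) has_vector_derivative Vx x t) (at x)"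
    and dVx: "((\<lambda>s. Vx s t) has_vector_derivative uxx x t + 2 * Pxx x t) (at x)"
    and dVt: "((\<lambda>\<tau>. V x \<tau>) has_vector_derivative ut x t + 2 * Pt x t) (at t)"
    and dVb: "((\<lambda>s. Vb s t) has_vector_derivative Vbx x t) (at x)" for x t
    unfolding V_def Vx_def Vb_def Vbx_def
    by (intro has_vector_derivative_add has_vector_derivative_diff const2 has_vector_derivative_cnj
        dux duxx dut dP dPx dPt dq)+
  define Lx where "Lx = (\<lambda>x t. 4 * \<i> * (Px x t * q 0 x t + P x t * qx x t)
    - 2 * \<i> * (Px x t * cnj (u x t) + P x t * cnj (ux x t)) + 2 * \<i> * (qx x t * u x t
        + q 0 x t * ux x t))"
  have dL: "((\<lambda>s. L s t) has_vector_derivative Lx x t) (at x)" for x t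
    unfolding L_def
    by (rule has_vector_derivative_eq_rhs,
        (rule has_vector_derivative_add has_vector_derivative_diff has_vector_derivative_mult
          dP dq dux has_vector_derivative_cnj has_vector_derivative_const)+)
       (simp add: Lx_def algebra_simps)
  define U where "U = (\<lambda>x t. G x t * V x t)"
  define W where "W = (\<lambda>x t. G x t * (2 * L x t * V x t + Vx x t))"
  have dU: "((\<lambda>s. U s t) has_vector_derivative W x t) (at x)" for x t
    unfolding U_def
    by (rule has_vector_derivative_eq_rhs[OF has_vector_derivative_mult[OF dG dV]])
       (simp add: W_def algebra_simps)
  have dUt: "((\<lambda>\<tau>. U x \<tau>) has_vector_derivative G x t * (2 * M x t * V x t + (ut x t
      + 2 * Pt x t))) (at t)" for x t
    unfolding U_def
    by (rule has_vector_derivative_eq_rhs[OF has_vector_derivative_mult[OF dGt dVt]])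
       (simp add: algebra_simps)
  have dW: "((\<lambda>s. W s t) has_vector_derivative G x t * (2 * L x t * (2 * L x t * V x t + Vx x t)
      + (2 * Lx x t * V x t + 2 * L x t * Vx x t + (uxx x t + 2 * Pxx x t)))) (at x)" for x t
    unfolding W_def
    by (rule has_vector_derivative_eq_rhs[OF has_vector_derivative_mult[OF dG
          has_vector_derivative_add[OF has_vector_derivative_mult[OF const2[OF dL] dV] dVx]]])
       (simp add: algebra_simps)
  \<comment> \<open>Two of the three factors G are conjugate to each other and cancel by |G| = 1, so
    the cubic term also carries exactly one G.\<close>
  have cubic: "complex_of_real ((cmod (U x t))\<^sup>2) * U x t = G x t * (V x t * Vb x t * V x t)" for x
      t
  proof -
    have "complex_of_real ((cmod (U x t))\<^sup>2) * U x t = (G x t * cnj (G x t)) * (G x t * (V x t * cnj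
        (V x t) * V x t))"
      unfolding sq U_def by (simp add: mult_ac)
    then show ?thesis
      by (simp only: G1 cV mult_1_left)
  qed
  have dC: "((\<lambda>s. complex_of_real ((cmod (U s t))\<^sup>2) * U s t) has_vector_derivative
      G x t * (2 * L x t * (V x t * Vb x t * V x t) + ((Vx x t * Vb x t + V x t * Vbx x t) * V x t
          + V x t * Vb x t * Vx x t))) (at x)" for x t
    unfolding cubic
    by (rule has_vector_derivative_eq_rhs[OF has_vector_derivative_mult[OF dG
          has_vector_derivative_mult[OF has_vector_derivative_mult[OF dV dVb] dV]]])
       (simp add: algebra_simps)
  have pxU: "px U = W"
    using dU by (intro ext) (simp add: px_def vector_derivative_at)
  have "dnls_solution U"
    unfolding dnls_solution_def
  proof (intro allI conjI)
    fix x t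
    show "(\<lambda>s. U s t) differentiable at x" "(\<lambda>\<tau>. U x \<tau>) differentiable at t"
      "(\<lambda>s. px U s t) differentiable at x"
      "(\<lambda>s. complex_of_real ((cmod (U s t))\<^sup>2) * U s t) differentiable at x"
      unfolding pxU by (rule differentiableI_vector, rule dU dUt dW dC)+
    have pt: "pt U x t = G x t * (2 * M x t * V x t + (ut x t + 2 * Pt x t))"
      using dUt by (simp add: pt_def vector_derivative_at)
    have pxx: "px (px U) x t = G x t * (2 * L x t * (2 * L x t * V x t + Vx x t)
      + (2 * Lx x t * V x t + 2 * L x t * Vx x t + (uxx x t + 2 * Pxx x t)))"
      unfolding pxU using dW by (simp add: px_def vector_derivative_at)
    have pxc: "px (\<lambda>y \<tau>. complex_of_real ((cmod (U y \<tau>))\<^sup>2) * U y \<tau>) x t = G x t * (2 * L x t * (V x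
        t * Vb x t * V x t)
       + ((Vx x t * Vb x t + V x t * Vbx x t) * V x t + V x t * Vb x t * Vx x t))"
      unfolding px_def using dC by (rule vector_derivative_at)
    \<comment> \<open>This is the equation for U with the common factor G removed.\<close>
    have "\<i> * (2 * M x t * V x t + (ut x t + 2 * Pt x t)) + (2 * L x t * (2 * L x t * V x t
        + Vx x t)
      + (2 * Lx x t * V x t + 2 * L x t * Vx x t + (uxx x t + 2 * Pxx x t)))
      + 2 * \<i> * (2 * L x t * (V x t * Vb x t * V x t) + ((Vx x t * Vb x t + V x t * Vbx x t) * V x t
          + V x t * Vb x t * Vx x t)) = 0"
      by (rule dnls_identity[where I = "\<i>" and P = "P x t" and Px = "Px x t" and Pt = "Pt x t" and
          Pxx = "Pxx x t" and
        qx = "qx x t" and M = "M x t" and L = "L x t" and Lx = "Lx x t" and u = "u x t" and ux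
        = "ux x t" and uxx = "uxx x t" and ut = "ut x t" and v = "V x t" and w = "Vb x t" and
        vx = "Vx x t" and wx = "Vbx x t" and q = "q 0 x t" and ub = "cnj (u x t)" and ubx =
        "cnj (ux x t)" and ra = "r 0 x t" and rb = "r 1 x t" and sa = "s 1 x t" and sb = "s 2 x
        t" and qa = "q 1 x t" and pa = "p 1 x t" and pb = "p 2 x t"])
         (simp_all only: Px_def Pt_def Pxx_def qx_def M_def L_def Lx_def V_def Vb_def Vx_def Vbx_def
            power2_eq_square eq_u i_squared)
    then show "\<i> * pt U x t + px (px U) x t
        + 2 * \<i> * px (\<lambda>y \<tau>. complex_of_real ((cmod (U y \<tau>))\<^sup>2) * U y \<tau>) x t = 0"
      unfolding pt pxx pxc by algebra
  qed
  then show ?thesis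
    by (simp only: U_def G_def V_def defs)
qed

section \<open>The Lax pair in components and the theorem\<close>

lemma Umat_vec:
  "(Umat a l *v v) $ 1 = - 2 * \<i> * l\<^sup>2 * v $ 1 + 2 * \<i> * l * a * v $ 2"
  "(Umat a l *v v) $ 2 = 2 * \<i> * l\<^sup>2 * v $ 2 + 2 * \<i> * l * cnj a * v $ 1"
  by (simp_all add: Umat_def mscale_def sigma3_def Qm_def matrix_vector_mult_def sum_2
      algebra_simps)

lemma Vmat_vec:
  "(Vmat a ax l *v v) $ 1 = (4 * l\<^sup>2 - 2 * a * cnj a) * (- 2 * \<i> * l\<^sup>2 * v $ 1
      + 2 * \<i> * l * a * v $ 2)
    - 2 * l * ax * v $ 2"
  "(Vmat a ax l *v v) $ 2 = (4 * l\<^sup>2 - 2 * a * cnj a) * (2 * \<i> * l\<^sup>2 * v $ 2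
      + 2 * \<i> * l * cnj a * v $ 1)
    + 2 * l * cnj ax * v $ 1"
  by (simp_all add: Vmat_def Umat_def mscale_def sigma3_def Qm_def matrix_vector_mult_def
      matrix_matrix_mult_def
      sum_2 mat_def algebra_simps)

lemma has_vector_derivative_vec_nth:
  fixes f :: "real \<Rightarrow> complex^'m"
  assumes "(f has_vector_derivative f') F"
  shows "((\<lambda>s. f s $ i) has_vector_derivative f' $ i) F"
  by (rule bounded_linear.has_vector_derivative[OF bounded_linear_vec_nth assms])

theorem mainTheorem1:
  fixes u :: "real \<Rightarrow> real \<Rightarrow> complex"
    and lam :: "'n::finite \<Rightarrow> complex"
    and phi :: "'n \<Rightarrow> real \<Rightarrow> real \<Rightarrow> complex^2"
  assumes u_bdd: "\<And>t. bounded (range (\<lambda>x. u x t))"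
    and u_smooth: "\<And>t. smooth_fun (\<lambda>x. u x t)"
    and u_sol: "dnls_solution u"
    and lam_cond: "\<And>i j. cnj (lam j) \<noteq> lam i \<and> cnj (lam j) \<noteq> - lam i"
    and lax_x: "\<And>i x t. ((\<lambda>s. phi i s t) has_vector_derivative
                   (Umat (u x t) (lam i) *v phi i x t)) (at x)"
    and lax_t: "\<And>i x t. ((\<lambda>\<tau>. phi i x \<tau>) has_vector_derivative
                   (Vmat (u x t) (px u x t) (lam i) *v phi i x t)) (at t)"
    and M_inv: "\<And>x t. invertible (Mmat lam (\<lambda>i. phi i x t))"
    and den_nz: "\<And>x t. 1 - 2 * cdot (\<chi> i. phi i x t $ 2)
                   ((ctrans (Lam lam) ** matrix_inv (ctrans (Mmat lam (\<lambda>i. phi i x t))))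
                     *v (\<chi> i. phi i x t $ 2)) \<noteq> 0"
  shows "dnls_solution (\<lambda>x t. uN lam (\<lambda>i. phi i x t) (u x t))"
proof -
  define z where "z = (\<lambda>i. (lam i)\<^sup>2)"
  define A :: "real \<Rightarrow> real \<Rightarrow> complex^'n" where "A = (\<lambda>x t. \<chi> i. lam i * phi i x t $ 1)"
  define B :: "real \<Rightarrow> real \<Rightarrow> complex^'n" where "B = (\<lambda>x t. \<chi> i. phi i x t $ 2)"
  have sep: "cnj (z j) \<noteq> z i" for i j
    unfolding z_def by (rule lam_sq_sep[OF lam_cond])
  have inv: "invertible (cauchy_mat z (A x t) (B x t))" for x t
    unfolding z_def A_def B_def by (rule invertible_cauchy_mat[OF lam_cond M_inv])
  have X: "cauchy_curve z (\<lambda>s. A s t) (\<lambda>s. B s t)" for t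
    by unfold_locales (simp_all add: sep inv)
  have T: "cauchy_curve z (A x) (B x)" for x
    by unfold_locales (simp_all add: sep inv)
  note lax_x' = has_vector_derivative_vec_nth[OF lax_x] and lax_t' =
      has_vector_derivative_vec_nth[OF lax_t]
  \<comment> \<open>The factor lambda_i built into A turns the odd powers of lambda_i in the
    off-diagonal entries into powers of z_i.\<close>
  have fx: "cauchy_curve.flow_x z (\<lambda>s. A s t) (\<lambda>s. B s t) (u x t) x" for x t
    unfolding cauchy_curve.flow_x_def[OF X] vder_def
  proof (intro conjI allI)
    fix i
    show "((\<lambda>s. A s t $ i) has_vector_derivative
        ((- 2 * \<i>) *s dg z (A x t) + (2 * \<i> * u x t) *s dg z (B x t)) $ i) (at x)"
      unfolding A_def B_def z_def vec_lambda_beta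
      by (rule has_vector_derivative_eq_rhs[OF has_vector_derivative_mult_right[OF lax_x']])
         (simp add: Umat_vec algebra_simps power2_eq_square)
    show "((\<lambda>s. B s t $ i) has_vector_derivative
        ((2 * \<i>) *s dg z (B x t) + (2 * \<i> * cnj (u x t)) *s A x t) $ i) (at x)"
      unfolding A_def B_def z_def vec_lambda_beta
      by (rule has_vector_derivative_eq_rhs[OF lax_x'])
         (simp add: Umat_vec algebra_simps power2_eq_square)
  qed
  have ft: "cauchy_curve.flow_t z (A x) (B x) (u x t) (px u x t) t" for x t
    unfolding cauchy_curve.flow_t_def[OF T] vder_def
  proof (intro conjI allI)
    fix i
    show "((\<lambda>s. A x s $ i) has_vector_derivative
        ((- 8 * \<i>) *s dg z (dg z (A x t)) + (8 * \<i> * u x t) *s dg z (dg z (B x t))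
        + (4 * \<i> * u x t * cnj (u x t)) *s dg z (A x t)
        + (- 4 * \<i> * u x t * u x t * cnj (u x t) - 2 * px u x t) *s dg z (B x t)) $ i) (at t)"
      unfolding A_def B_def z_def vec_lambda_beta
      by (rule has_vector_derivative_eq_rhs[OF has_vector_derivative_mult_right[OF lax_t']])
         (simp add: Vmat_vec algebra_simps power2_eq_square)
    show "((\<lambda>s. B x s $ i) has_vector_derivative
        ((8 * \<i>) *s dg z (dg z (B x t)) + (8 * \<i> * cnj (u x t)) *s dg z (A x t)
        + (- 4 * \<i> * u x t * cnj (u x t)) *s dg z (B x t)
        + (- 4 * \<i> * u x t * cnj (u x t) * cnj (u x t) + 2 * cnj (px u x t)) *s A x t) $ i) (at t)"
      unfolding A_def B_def z_def vec_lambda_beta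
      by (rule has_vector_derivative_eq_rhs[OF lax_t'])
         (simp add: Vmat_vec algebra_simps power2_eq_square)
  qed
  have "uN lam (\<lambda>i. phi i x t) (u x t) = cauchy.gg z (A x t) (B x t) * cauchy.hh z (A x t) (B x t)
      * (u x t + 2 * cauchy.PP z (A x t) (B x t))" for x t
    unfolding z_def A_def B_def by (rule uN_eq[OF lam_cond M_inv])
  then show ?thesis
    using dnls_dressing[OF X T fx ft u_sol] by simp
qed

end
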